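(* Assume we are given data $\{(x_n,y_n)\}_{n=1}^N\subseteq X\times\mathbb{R}^d$. Let $L\colon\mathbb{R}^d\times\mathbb{R}^d\to\mathbb{R}$ be such that for every $y\in\mathbb{R}^d$, the map $L(\cdot,y)$ is convex, coercive, and lower semicontinuous. Let $\mathcal{B}$ be an integral vv-RKBS of functions from $X$ to a Banach space $\mathcal{U}$ with predual $\mathcal{U}_*$ (so $(\mathcal{U}_* )^*=\mathcal{U}$) and with weight space $\Omega$ and integrand $\phi$. Suppose there exists a bounded linear operator $M\colon\mathcal{U}\to\mathbb{R}^d$ of the form $$(Mu)_j=\langle u,v_j\rangle_{\mathcal{U}_*},\qquad j=1,\dots,d,$$ where $v_j\in\mathcal{U}_*$ and $\langle\cdot,\cdot\rangle_{\mathcal{U}_*}$ is the canonical duality pairing between $\mathcal{U}_*$ and $(\mathcal{U}_* )^*=\mathcal{U}$. Then, for $\lambda\ge0$, there exists a solution to the supervised learning problem $$\min_{f\in\mathcal{B}}\ \frac1N\sum_{n=1}^N L(M(f(x_n)),y_n)+\lambda\|f\|_{\mathcal{B}}$$ that admits a representation of the form $$\mu^\dagger=\sum_{m=1}^{Nd}a_m\,\delta_{w_m}u_m,\qquad f^\dagger=A_{\Omega\to X}\mu^\dagger=\sum_{m=1}^{Nd}a_m\,\phi(\cdot,w_m)u_m,$$ with $w_m\in\Omega$, $u_m\in\operatorname{Ext}(\{u\in\mathcal{U}:\|u\|_{\mathcal{U}}\le1\})$ and $a_m\in\mathbb{R}$.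
   Context: All vector spaces are real. $\operatorname{Ext}(S)$ is the set of extreme points of a convex set $S$; $\delta_w u$ is the $\mathcal{U}$-valued measure $E\mapsto u$ if $w\in E$ and $0$ otherwise. For a Banach space $V$ and a locally compact Hausdorff space $\Omega$, $\mathcal{M}(\Omega;V)$ is the space of regular countably additive $V$-valued Borel vector measures of finite total variation; $|\mu|_V$ is the total variation measure of $\mu$. $C_0(\cdot)$ denotes continuous real functions vanishing at infinity. Integral vv-RKBS: given locally compact Hausdorff spaces $X$ (input space) and $\Omega$ (weight space), $\phi\in C_0(X\times\Omega)$ and a Banach space $\mathcal{U}$ (which in the general definition is part of a dual pair of Banach spaces $(\mathcal{U},\mathcal{U}^\diamond)$ with continuous nondegenerate pairing, but $\mathcal{B}$ itself depends only on $X,\Omega,\phi,\mathcal{U}$), define $(A_{\Omega\to X}\mu)(x):=\int_\Omega\phi(x,w)\,d\mu(w)$ for $\mu\in\mathcal{M}(\Omega;\mathcal{U})$, and $$\mathcal{B}:=\{f=A_{\Omega\to X}\mu\mid\mu\in\mathcal{M}(\Omega;\mathcal{U})\},\qquad\|f\|_{\mathcal{B}}:=\inf_{f=A_{\Omega\to X}\mu}|\mu|_{\mathcal{U}}(\Omega).$$ *)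

theory Defs
  imports "HOL-Analysis.Analysis"
begin

section \<open>Functions\<close>

definition lower_semicontinuous :: "('a::topological_space \<Rightarrow> real) \<Rightarrow> bool" where
  "lower_semicontinuous f \<longleftrightarrow> (\<forall>x. \<forall>c < f x. \<forall>\<^sub>F y in nhds x. c < f y)"

definition coercive :: "('a::real_normed_vector \<Rightarrow> real) \<Rightarrow> bool" where
  "coercive f \<longleftrightarrow> filterlim f at_top at_infinity"

definition C0 :: "('a::topological_space \<Rightarrow> real) set" where
  "C0 = {f. continuous_on UNIV f \<and> (\<forall>\<epsilon>>0. compact {x. \<bar>f x\<bar> \<ge> \<epsilon>})}"

section \<open>Banach-space valued Borel measures\<close>

text \<open>
  A vector measure is represented by a set function; only its values on Borel sets are
  constrained or used, so two set functions agreeing on the Borel sets stand for the same measure.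
\<close>

definition vv_countably_additive ::
    "('w::topological_space set \<Rightarrow> 'u::real_normed_vector) \<Rightarrow> bool" where
  "vv_countably_additive \<mu> \<longleftrightarrow>
     (\<forall>A :: nat \<Rightarrow> 'w set. range A \<subseteq> sets borel \<longrightarrow> disjoint_family A \<longrightarrow>
        (\<lambda>i. \<mu> (A i)) sums \<mu> (\<Union>i. A i))"

definition total_variation ::
    "('w::topological_space set \<Rightarrow> 'u::real_normed_vector) \<Rightarrow> 'w set \<Rightarrow> ennreal" where
  "total_variation \<mu> E =
     (SUP P \<in> {P. finite P \<and> P \<subseteq> sets borel \<and> partition_on E P}. \<Sum>A\<in>P. ennreal (norm (\<mu> A)))"

definition vv_regular ::
    "('w::topological_space set \<Rightarrow> 'u::real_normed_vector) \<Rightarrow> bool" where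
  "vv_regular \<mu> \<longleftrightarrow>
     (\<forall>E \<in> sets borel. \<forall>\<epsilon>>0. \<exists>K G. compact K \<and> open G \<and> K \<subseteq> E \<and> E \<subseteq> G \<and>
        total_variation \<mu> (G - K) < ennreal \<epsilon>)"

definition vv_measures :: "('w::topological_space set \<Rightarrow> 'u::real_normed_vector) set" where
  "vv_measures =
     {\<mu>. vv_countably_additive \<mu> \<and> total_variation \<mu> UNIV < \<infinity> \<and> vv_regular \<mu>}"

definition vv_dirac :: "'w \<Rightarrow> 'u::real_normed_vector \<Rightarrow> 'w set \<Rightarrow> 'u" where
  "vv_dirac w u E = (if w \<in> E then u else 0)"

text \<open>
  The integral of a bounded Borel function against a vector measure of finite variation is the
  limit of the integrals of simple functions converging uniformly to it. The limit exists in a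
  Banach space and does not depend on the sequence, since the integral of a simple function
  \<open>s\<close> has norm at most the supremum of \<open>\<bar>s\<bar>\<close> times the total variation.
\<close>

definition vv_simple_integral ::
    "('w::topological_space set \<Rightarrow> 'u::real_normed_vector) \<Rightarrow> ('w \<Rightarrow> real) \<Rightarrow> 'u" where
  "vv_simple_integral \<mu> s = (\<Sum>c\<in>range s. c *\<^sub>R \<mu> (s -` {c}))"

definition has_vv_integral ::
    "('w::topological_space set \<Rightarrow> 'u::real_normed_vector) \<Rightarrow> ('w \<Rightarrow> real) \<Rightarrow> 'u \<Rightarrow> bool" where
  "has_vv_integral \<mu> f I \<longleftrightarrow>
     (\<exists>s :: nat \<Rightarrow> 'w \<Rightarrow> real. (\<forall>n. simple_function borel (s n)) \<and>
        uniform_limit UNIV s f sequentially \<and> (\<lambda>n. vv_simple_integral \<mu> (s n)) \<longlonglongrightarrow> I)"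

definition vv_integral ::
    "('w::topological_space set \<Rightarrow> 'u::real_normed_vector) \<Rightarrow> ('w \<Rightarrow> real) \<Rightarrow> 'u" where
  "vv_integral \<mu> f = (THE I. has_vv_integral \<mu> f I)"

section \<open>Integral vector-valued reproducing kernel Banach spaces\<close>

definition rkbs_op ::
    "('x \<times> 'w::topological_space \<Rightarrow> real) \<Rightarrow> ('w set \<Rightarrow> 'u::real_normed_vector) \<Rightarrow> 'x \<Rightarrow> 'u" where
  "rkbs_op \<phi> \<mu> x = vv_integral \<mu> (\<lambda>w. \<phi> (x, w))"

definition rkbs ::
    "('x \<times> 'w::topological_space \<Rightarrow> real) \<Rightarrow> ('x \<Rightarrow> 'u::real_normed_vector) set" where
  "rkbs \<phi> = {f. \<exists>\<mu> \<in> vv_measures. f = rkbs_op \<phi> \<mu>}"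

definition rkbs_norm ::
    "('x \<times> 'w::topological_space \<Rightarrow> real) \<Rightarrow> ('x \<Rightarrow> 'u::real_normed_vector) \<Rightarrow> real" where
  "rkbs_norm \<phi> f =
     Inf {enn2real (total_variation \<mu> UNIV) |\<mu>. \<mu> \<in> vv_measures \<and> f = rkbs_op \<phi> \<mu>}"

section \<open>Preduals\<close>

text \<open>
  \<open>J\<close> identifies \<open>'u\<close> with the dual space of \<open>'p\<close>; the canonical pairing of \<open>u\<close> and \<open>v\<close> is
  \<open>blinfun_apply (J u) v\<close>.
\<close>

definition predual_identification ::
    "('u::real_normed_vector \<Rightarrow> 'p::real_normed_vector \<Rightarrow>\<^sub>L real) \<Rightarrow> bool" where
  "predual_identification J \<longleftrightarrow> linear J \<and> surj J \<and> (\<forall>u. norm (J u) = norm u)"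

section \<open>Supervised learning\<close>

definition learning_objective ::
    "(real^'d \<Rightarrow> real^'d \<Rightarrow> real) \<Rightarrow> ('u::real_normed_vector \<Rightarrow> real^'d) \<Rightarrow> nat \<Rightarrow> (nat \<Rightarrow> 'x) \<Rightarrow>
     (nat \<Rightarrow> real^'d) \<Rightarrow> real \<Rightarrow> ('x \<times> 'w::topological_space \<Rightarrow> real) \<Rightarrow> ('x \<Rightarrow> 'u) \<Rightarrow> real" where
  "learning_objective L M N x y lam \<phi> f =
     (1 / real N) * (\<Sum>n=1..N. L (M (f (x n))) (y n)) + lam * rkbs_norm \<phi> f"

end

theory Submission
  imports Defs
begin

text \<open>
  Only the sampled values \<open>M (f (x n))\<close>, a vector of dimension \<open>N * d\<close>, enter the loss. The values of
  \<open>A \<mu>\<close> are limits of nonnegative combinations, of total weight at most the variation of \<open>\<mu>\<close>, of atoms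
  \<open>(\<phi> (x n, w) * M u)\<close> with \<open>norm u \<le> 1\<close>. By conic Caratheodory at most \<open>N * d\<close> atoms suffice, and
  the set of atoms is compact because the \<open>\<phi> (x n, -)\<close> vanish at infinity and the unit ball is
  weak-* compact; so a minimising sequence has a convergent subsequence whose limit is again such a
  combination. Krein-Milman for the image of the ball under \<open>M\<close>, with extreme points lifted through
  weak-* compact faces, replaces every \<open>u\<close> by extreme points, and a last use of conic Caratheodory
  brings the number of atoms back to \<open>N * d\<close>.
\<close>

section \<open>Conic combinations of finitely many atoms\<close>

text \<open>In general neither the weight space nor the unit ball of \<open>'u\<close> in its weak-*
  topology is sequentially compact, so minimising measures are never made to converge. Convergence
  is asked only of real numbers, namely coefficients, total weights and coordinates of atoms;
  compactness then finds an atom with the limiting coordinates. Caratheodory must come before the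
  limit, to fix the length of the sums. Its conic form gives \<open>N * d\<close> rather than
  \<open>N * d + 1\<close> because the total weight is not prescribed and only has to stay below its
  former value. That weight dominates the norm of the function generated by the atoms, and an upper
  bound is enough for optimality. For \<open>lam = 0\<close> the objective does not control the
  weight; coercivity then bounds the sampled values, and equivalence of norms in finite dimension
  provides other, bounded weights for them. Coercivity also bounds the loss from below, and
  convexity makes it continuous.\<close>

lemma exists_dependency:
  fixes v :: "'t \<Rightarrow> 'i \<Rightarrow> real"
  assumes "finite I" "finite T" "card I < card T"
  shows "\<exists>b. (\<exists>t\<in>T. b t \<noteq> 0) \<and> (\<forall>i\<in>I. (\<Sum>t\<in>T. b t * v t i) = 0)"
  using assms
proof (induction I arbitrary: T v rule: finite_induct)
  case empty
  then show ?case by (intro exI[of _ "\<lambda>_. 1"]) (auto simp: card_gt_0_iff)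
next
  case (insert i0 I)
  show ?case
  proof (cases "\<forall>t\<in>T. v t i0 = 0")
    case True
    have "card I < card T" using insert by simp
    then obtain b where "\<exists>t\<in>T. b t \<noteq> 0" "\<forall>i\<in>I. (\<Sum>t\<in>T. b t * v t i) = 0"
      using insert.IH[OF insert.prems(1), of v] by blast
    with True show ?thesis by (intro exI[of _ b]) auto
  next
    case False
    then obtain t0 where t0: "t0 \<in> T" "v t0 i0 \<noteq> 0" by auto
    \<comment> \<open>One step of Gaussian elimination with pivot \<open>t0\<close>: every
      \<open>w t\<close> vanishes at \<open>i0\<close>, and the coefficient given to
      \<open>t0\<close> in \<open>c\<close> restores a dependency of the original vectors.\<close>
    define w where "w t i = v t i - v t i0 / v t0 i0 * v t0 i" for t i
    have "card I < card (T - {t0})"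
      using insert t0 by (simp add: card_Diff_singleton)
    then obtain b where b: "\<exists>t\<in>T - {t0}. b t \<noteq> 0" "\<forall>i\<in>I. (\<Sum>t\<in>T - {t0}. b t * w t i) = 0"
      using insert.IH[of "T - {t0}" w] insert.prems(1) by blast
    define c where "c = b(t0 := - (\<Sum>t\<in>T - {t0}. b t * v t i0) / v t0 i0)"
    have eq: "(\<Sum>t\<in>T. c t * v t i) = (\<Sum>t\<in>T - {t0}. b t * w t i)" for i
    proof -
      have "(\<Sum>t\<in>T. c t * v t i) = c t0 * v t0 i + (\<Sum>t\<in>T - {t0}. c t * v t i)"
        using t0 insert.prems(1) by (simp add: sum.remove)
      also have "(\<Sum>t\<in>T - {t0}. c t * v t i) = (\<Sum>t\<in>T - {t0}. b t * v t i)"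
        by (rule sum.cong) (auto simp: c_def)
      also have "c t0 * v t0 i = - (\<Sum>t\<in>T - {t0}. b t * (v t i0 / v t0 i0 * v t0 i))"
        by (simp add: c_def sum_distrib_right sum_divide_distrib mult.assoc)
      finally show ?thesis
        by (simp add: w_def right_diff_distrib sum_subtractf)
    qed
    have "w t i0 = 0" for t using t0 by (simp add: w_def)
    then have "\<forall>i\<in>insert i0 I. (\<Sum>t\<in>T. c t * v t i) = 0"
      unfolding eq using b(2) by simp
    moreover have "\<exists>t\<in>T. c t \<noteq> 0" using b(1) by (auto simp: c_def)
    ultimately show ?thesis by blast
  qed
qed

text \<open>
  A linear dependency with nonnegative coefficient sum is subtracted until an atom disappears, so
  the total weight never increases.
\<close>

lemma conic_caratheodory:
  fixes v :: "'t \<Rightarrow> 'i \<Rightarrow> real"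
  assumes "finite I" "finite T" "\<And>t. t \<in> T \<Longrightarrow> 0 \<le> a t"
  shows "\<exists>T' a'. T' \<subseteq> T \<and> card T' \<le> card I \<and> (\<forall>t\<in>T'. 0 \<le> a' t) \<and> sum a' T' \<le> sum a T \<and>
           (\<forall>i\<in>I. (\<Sum>t\<in>T'. a' t * v t i) = (\<Sum>t\<in>T. a t * v t i))"
  using assms(2,3)
proof (induction T arbitrary: a rule: finite_psubset_induct)
  case (psubset T)
  show ?case
  proof (cases "card T \<le> card I")
    case True
    then show ?thesis using psubset.prems by blast
  next
    case False
    then obtain b0 where b0: "\<exists>t\<in>T. b0 t \<noteq> 0" "\<forall>i\<in>I. (\<Sum>t\<in>T. b0 t * v t i) = 0"
      using exists_dependency[OF assms(1) psubset.hyps, of v] by auto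
    define b where "b t = (if 0 \<le> sum b0 T then b0 t else - b0 t)" for t
    have b: "\<exists>t\<in>T. b t \<noteq> 0" "\<forall>i\<in>I. (\<Sum>t\<in>T. b t * v t i) = 0" "0 \<le> sum b T"
      using b0 by (cases "0 \<le> sum b0 T"; simp add: b_def sum_negf)+
    have "\<exists>t\<in>T. 0 < b t"
    proof (rule ccontr)
      assume "\<not> ?thesis"
      then have np: "\<forall>t\<in>T. b t \<le> 0" by (auto simp: not_less)
      then have "sum b T \<le> 0" by (simp add: sum_nonpos)
      with b(3) have "sum (\<lambda>t. - b t) T = 0" by (simp add: sum_negf)
      then have "\<forall>t\<in>T. - b t = 0"
        using np psubset.hyps by (subst (asm) sum_nonneg_eq_0_iff) auto
      with b(1) show False by auto
    qed
    then have ne: "{t\<in>T. 0 < b t} \<noteq> {}" and fin: "finite {t\<in>T. 0 < b t}"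
      using psubset.hyps by auto
    \<comment> \<open>The ratio test of the simplex method: subtracting the dependency with the
      smallest ratio keeps all coefficients nonnegative and makes the one at \<open>t0\<close>
      zero.\<close>
    obtain t0 where t0: "t0 \<in> T" "0 < b t0"
      and t0_min: "\<And>t. t \<in> T \<Longrightarrow> 0 < b t \<Longrightarrow> a t0 / b t0 \<le> a t / b t"
      using ex_is_arg_min_if_finite[OF fin ne, of "\<lambda>t. a t / b t"]
      by (auto simp: is_arg_min_linorder)
    define \<theta> where "\<theta> = a t0 / b t0"
    define a' where "a' t = a t - \<theta> * b t" for t
    have \<theta>0: "0 \<le> \<theta>" using t0 psubset.prems by (simp add: \<theta>_def)
    have a'0: "0 \<le> a' t" if "t \<in> T" for t
    proof (cases "0 < b t")
      case True
      then show ?thesis using t0_min[OF that True] by (simp add: a'_def \<theta>_def pos_le_divide_eq)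
    next
      case False
      then have "\<theta> * b t \<le> 0" using \<theta>0 by (simp add: mult_nonneg_nonpos)
      then show ?thesis using psubset.prems[OF that] by (simp add: a'_def)
    qed
    have a't0: "a' t0 = 0" using t0 by (simp add: a'_def \<theta>_def)
    \<comment> \<open>Kept general in \<open>g\<close>: the constant 1 gives the total weight, the
      coordinates of \<open>v\<close> give the represented vector.\<close>
    have sum_eq: "(\<Sum>t\<in>T - {t0}. a' t * g t) = (\<Sum>t\<in>T. a t * g t) - \<theta> * (\<Sum>t\<in>T. b t * g t)"
      for g :: "'t \<Rightarrow> real"
    proof -
      have "(\<Sum>t\<in>T - {t0}. a' t * g t) = (\<Sum>t\<in>T. a' t * g t)"
        using a't0 t0 psubset.hyps by (simp add: sum.remove)
      then show ?thesis
        by (simp add: a'_def left_diff_distrib sum_subtractf sum_distrib_left mult.assoc)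
    qed
    have "T - {t0} \<subset> T" using t0 by auto
    from psubset.IH[OF this, of a'] a'0
    obtain T'' a'' where "T'' \<subseteq> T - {t0}" "card T'' \<le> card I" "\<forall>t\<in>T''. 0 \<le> a'' t"
      "sum a'' T'' \<le> sum a' (T - {t0})"
      "\<forall>i\<in>I. (\<Sum>t\<in>T''. a'' t * v t i) = (\<Sum>t\<in>T - {t0}. a' t * v t i)"
      by blast
    moreover have "sum a' (T - {t0}) \<le> sum a T"
      using sum_eq[of "\<lambda>_. 1"] \<theta>0 b(3) by simp
    ultimately show ?thesis
      using b(2) by (intro exI[of _ T''] exI[of _ a'']) (auto simp: sum_eq)
  qed
qed

text \<open>
  Since \<open>N\<close> is a variable, the space of dimension \<open>N * CARD('d)\<close> cannot be a type; its vectors are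
  functions read only on a finite index set \<open>I\<close>. The least \<open>K\<close> below is the atomic norm of \<open>f\<close>.
\<close>

definition conic_rep :: "'i set \<Rightarrow> ('t \<Rightarrow> 'i \<Rightarrow> real) \<Rightarrow> 't set \<Rightarrow> ('i \<Rightarrow> real) \<Rightarrow> real \<Rightarrow> bool" where
  "conic_rep I v A f K \<longleftrightarrow> (\<exists>T a. finite T \<and> T \<subseteq> A \<and> (\<forall>t\<in>T. 0 \<le> a t) \<and> sum a T \<le> K \<and>
     (\<forall>i\<in>I. f i = (\<Sum>t\<in>T. a t * v t i)))"

section \<open>Calculus of conic representations\<close>

lemma conic_rep_nonneg:
  assumes "conic_rep I v A f K"
  shows "0 \<le> K"
proof -
  from assms obtain T a where "finite T" "T \<subseteq> A" "\<forall>t\<in>T. 0 \<le> a t" "sum a T \<le> K"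
     "\<forall>i\<in>I. f i = (\<Sum>t\<in>T. a t * v t i)" unfolding conic_rep_def by blast
  then have "0 \<le> sum a T" by (intro sum_nonneg) blast
  also note \<open>sum a T \<le> K\<close>
  finally show ?thesis .
qed

lemma conic_rep_mono:
  assumes "conic_rep I v A f K" "K \<le> K'" "\<And>i. i \<in> I \<Longrightarrow> f i = g i"
  shows "conic_rep I v A g K'"
proof -
  from assms(1) obtain T a where T: "finite T" "T \<subseteq> A" "\<forall>t\<in>T. 0 \<le> a t" "sum a T \<le> K"
     "\<forall>i\<in>I. f i = (\<Sum>t\<in>T. a t * v t i)" unfolding conic_rep_def by blast
  then show ?thesis
    unfolding conic_rep_def using assms(2,3) by (intro exI[of _ T] exI[of _ a]) simp
qed

lemma conic_rep_zero: "0 \<le> K \<Longrightarrow> (\<And>i. i \<in> I \<Longrightarrow> f i = 0) \<Longrightarrow> conic_rep I v A f K"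
  unfolding conic_rep_def by (rule exI[of _ "{}"], rule exI[of _ "\<lambda>_. 0"]) simp

lemma conic_rep_atom: "t \<in> A \<Longrightarrow> conic_rep I v A (v t) 1"
  unfolding conic_rep_def by (intro exI[of _ "{t}"] exI[of _ "\<lambda>_. 1"]) auto

lemma conic_rep_scale:
  assumes "conic_rep I v A f K" "0 \<le> r"
  shows "conic_rep I v A (\<lambda>i. r * f i) (r * K)"
proof -
  from assms(1) obtain T a where T: "finite T" "T \<subseteq> A" "\<forall>t\<in>T. 0 \<le> a t" "sum a T \<le> K"
     "\<forall>i\<in>I. f i = (\<Sum>t\<in>T. a t * v t i)" unfolding conic_rep_def by blast
  have "(\<Sum>t\<in>T. r * a t) \<le> r * K"
    using T(4) assms(2) by (simp add: mult_left_mono flip: sum_distrib_left)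
  with T show ?thesis unfolding conic_rep_def
    using assms(2)
    by (intro exI[of _ T] exI[of _ "\<lambda>t. r * a t"]) (simp add: sum_distrib_left mult.assoc)
qed

lemma conic_rep_add:
  assumes "conic_rep I v A f K" "conic_rep I v A g L"
  shows "conic_rep I v A (\<lambda>i. f i + g i) (K + L)"
proof -
  from assms(1) obtain T a where T: "finite T" "T \<subseteq> A" "\<forall>t\<in>T. 0 \<le> a t" "sum a T \<le> K"
     "\<forall>i\<in>I. f i = (\<Sum>t\<in>T. a t * v t i)" unfolding conic_rep_def by blast
  from assms(2) obtain S b where S: "finite S" "S \<subseteq> A" "\<forall>t\<in>S. 0 \<le> b t" "sum b S \<le> L"
     "\<forall>i\<in>I. g i = (\<Sum>t\<in>S. b t * v t i)" unfolding conic_rep_def by blast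
  \<comment> \<open>An atom may occur in both sums, so the coefficients add up on the
    overlap.\<close>
  define c where "c t = (if t \<in> T then a t else 0) + (if t \<in> S then b t else 0)" for t
  have c: "(\<Sum>t\<in>T \<union> S. c t * h t) = (\<Sum>t\<in>T. a t * h t) + (\<Sum>t\<in>S. b t * h t)" for h :: "_ \<Rightarrow> real"
  proof -
    have "(\<Sum>t\<in>T \<union> S. c t * h t) = (\<Sum>t\<in>T \<union> S. if t \<in> T then a t * h t else 0)
        + (\<Sum>t\<in>T \<union> S. if t \<in> S then b t * h t else 0)"
      by (subst sum.distrib[symmetric], rule sum.cong) (auto simp: c_def distrib_right)
    then show ?thesis
      using T(1) S(1) by (simp add: sum.If_cases Un_Int_eq)
  qed
  show ?thesis
    unfolding conic_rep_def
  proof (intro exI[of _ "T \<union> S"] exI[of _ c] conjI)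
    show "sum c (T \<union> S) \<le> K + L" using c[of "\<lambda>_. 1"] T(4) S(4) by simp
    show "\<forall>t\<in>T \<union> S. 0 \<le> c t" using T(3) S(3) by (auto simp: c_def)
    show "\<forall>i\<in>I. f i + g i = (\<Sum>t\<in>T \<union> S. c t * v t i)"
    proof
      fix i assume "i \<in> I"
      then show "f i + g i = (\<Sum>t\<in>T \<union> S. c t * v t i)"
        using T(5) S(5) c[of "\<lambda>t. v t i"] by simp
    qed
  qed (use T S in auto)
qed

lemma conic_rep_sum:
  assumes "finite S" "\<And>s. s \<in> S \<Longrightarrow> conic_rep I v A (f s) (K s)"
  shows "conic_rep I v A (\<lambda>i. \<Sum>s\<in>S. f s i) (sum K S)"
  using assms
proof (induction rule: finite_induct)
  case empty
  show ?case by (simp add: conic_rep_zero)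
next
  case (insert x F)
  then show ?case using conic_rep_add[of I v A "f x" "K x"] by simp
qed

text \<open>Substituting combinations of total weight at most 1 for the atoms leaves the bound on
  the total weight intact. This is how elements of the ball are traded for extreme points.\<close>

lemma conic_rep_trans:
  assumes "\<And>t. t \<in> A \<Longrightarrow> conic_rep I v B (v t) 1" "conic_rep I v A f K"
  shows "conic_rep I v B f K"
proof -
  from assms(2) obtain T a where T: "finite T" "T \<subseteq> A" "\<forall>t\<in>T. 0 \<le> a t" "sum a T \<le> K"
     "\<forall>i\<in>I. f i = (\<Sum>t\<in>T. a t * v t i)" unfolding conic_rep_def by blast
  have "conic_rep I v B (\<lambda>i. \<Sum>t\<in>T. a t * v t i) (\<Sum>t\<in>T. a t * 1)"
    using T(1-3) by (intro conic_rep_sum conic_rep_scale assms(1)) auto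
  then show ?thesis by (rule conic_rep_mono) (use T in auto)
qed

text \<open>When the atoms are symmetric, a negative sign can be absorbed into them, so the atomic
  norm scales by the absolute value.\<close>

lemma conic_rep_mult:
  assumes sym: "\<And>t. t \<in> A \<Longrightarrow> \<exists>t'\<in>A. \<forall>i\<in>I. v t' i = - v t i"
    and "conic_rep I v A f K"
  shows "conic_rep I v A (\<lambda>i. r * f i) (\<bar>r\<bar> * K)"
proof (cases "0 \<le> r")
  case True
  then show ?thesis using conic_rep_scale[OF assms(2)] by simp
next
  case False
  from assms(2) obtain T a where T: "finite T" "T \<subseteq> A" "\<forall>t\<in>T. 0 \<le> a t" "sum a T \<le> K"
     "\<forall>i\<in>I. f i = (\<Sum>t\<in>T. a t * v t i)" unfolding conic_rep_def by blast
  have "conic_rep I v A (\<lambda>i. - v t i) 1" if "t \<in> T" for t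
  proof -
    obtain t' where "t' \<in> A" "\<forall>i\<in>I. v t' i = - v t i" using sym[of t] \<open>t \<in> T\<close> T(2) by blast
    then show ?thesis using conic_rep_mono[OF conic_rep_atom[of t' A I v] order_refl] by simp
  qed
  then have "conic_rep I v A (\<lambda>i. \<Sum>t\<in>T. a t * (- v t i)) (\<Sum>t\<in>T. a t * 1)"
    using T(1,3) by (intro conic_rep_sum conic_rep_scale) auto
  then have "conic_rep I v A (\<lambda>i. - f i) K"
    by (rule conic_rep_mono) (use T in \<open>auto simp: sum_negf\<close>)
  from conic_rep_scale[OF this, of "- r"] False show ?thesis by simp
qed

text \<open>Normal form of a representation after Caratheodory. The length is always
  \<open>card I\<close>, reached by padding with zero weights, so that a sequence of representations
  can be followed index by index.\<close>

lemma conic_rep_indexed: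
  assumes "finite I" "conic_rep I v A f K" "A \<noteq> {}"
  shows "\<exists>t a. (\<forall>m. t m \<in> A) \<and> (\<forall>m. 0 \<le> a m) \<and> (\<Sum>m=1..card I. a m) \<le> K \<and>
           (\<forall>i\<in>I. f i = (\<Sum>m=1..card I. a m * v (t m) i))"
proof -
  from assms(2) obtain S b where S: "finite S" "S \<subseteq> A" "\<forall>t\<in>S. 0 \<le> b t" "sum b S \<le> K"
     "\<forall>i\<in>I. f i = (\<Sum>t\<in>S. b t * v t i)" unfolding conic_rep_def by blast
  obtain T a where T: "T \<subseteq> S" "card T \<le> card I" "\<forall>t\<in>T. 0 \<le> a t" "sum a T \<le> sum b S"
     "\<forall>i\<in>I. (\<Sum>t\<in>T. a t * v t i) = (\<Sum>t\<in>S. b t * v t i)"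
    using conic_caratheodory[OF assms(1) S(1), of b v] S(3) by blast
  have "finite T" using T(1) S(1) finite_subset by blast
  then obtain h where h: "bij_betw h {1..card T} T"
    using ex_bij_betw_nat_finite_1 by blast
  obtain t0 where "t0 \<in> A" using assms(3) by auto
  define t where "t m = (if m \<in> {1..card T} then h m else t0)" for m
  define c where "c m = (if m \<in> {1..card T} then a (h m) else 0)" for m
  have hT: "h m \<in> T" if "m \<in> {1..card T}" for m using h that by (auto simp: bij_betw_def)
  have eq: "(\<Sum>m=1..card I. c m * g (t m)) = (\<Sum>s\<in>T. a s * g s)" for g :: "_ \<Rightarrow> real"
  proof -
    have "(\<Sum>m=1..card I. c m * g (t m)) = (\<Sum>m=1..card T. c m * g (t m))"
      using T(2) by (intro sum.mono_neutral_right) (auto simp: c_def)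
    also have "\<dots> = (\<Sum>m\<in>{1..card T}. a (h m) * g (h m))"
      by (rule sum.cong) (auto simp: c_def t_def)
    also have "\<dots> = (\<Sum>s\<in>T. a s * g s)" by (rule sum.reindex_bij_betw[OF h])
    finally show ?thesis .
  qed
  show ?thesis
  proof (intro exI[of _ t] exI[of _ c] conjI allI ballI)
    show "t m \<in> A" for m using hT[of m] T(1) S(2) \<open>t0 \<in> A\<close> by (auto simp: t_def)
    show "0 \<le> c m" for m using hT[of m] T(3) by (auto simp: c_def)
    show "(\<Sum>m=1..card I. c m) \<le> K" using eq[of "\<lambda>_. 1"] T(4) S(4) by simp
    show "f i = (\<Sum>m=1..card I. c m * v (t m) i)" if "i \<in> I" for i
      unfolding eq[of "\<lambda>s. v s i"] using T(5) S(5) that by simp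
  qed
qed

text \<open>All norms on a finite-dimensional space are equivalent; this supplies compactness when \<open>lam = 0\<close>.\<close>

lemma conic_rep_bounded:
  fixes v :: "'t \<Rightarrow> 'i \<Rightarrow> real"
  assumes "finite I" and sym: "\<And>t. t \<in> A \<Longrightarrow> \<exists>t'\<in>A. \<forall>i\<in>I. v t' i = - v t i"
  shows "\<exists>C\<ge>0. \<forall>f K. conic_rep I v A f K \<longrightarrow> conic_rep I v A f (C * (\<Sum>i\<in>I. \<bar>f i\<bar>))"
proof -
  \<comment> \<open>Induction on the set \<open>J\<close> of coordinates that may be nonzero. The
    constant may depend on \<open>J\<close>, but not on \<open>f\<close> or
    \<open>K\<close>.\<close>
  have "finite J \<Longrightarrow> J \<subseteq> I \<Longrightarrow>
     \<exists>C\<ge>0. \<forall>f K. conic_rep I v A f K \<longrightarrow> (\<forall>i\<in>I - J. f i = 0) \<longrightarrow>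
       conic_rep I v A f (C * (\<Sum>i\<in>I. \<bar>f i\<bar>))" for J
  proof (induction J rule: finite_induct)
    case empty
    show ?case by (intro exI[of _ 0]) (auto intro: conic_rep_zero)
  next
    case (insert i0 J)
    then obtain C where C: "0 \<le> C" and
      IH: "\<And>f K. conic_rep I v A f K \<Longrightarrow> (\<forall>i\<in>I - J. f i = 0) \<Longrightarrow>
        conic_rep I v A f (C * (\<Sum>i\<in>I. \<bar>f i\<bar>))" by blast
    \<comment> \<open>Either all representable vectors supported in the larger set vanish at
      \<open>i0\<close>, and the old constant serves, or one of them is fixed as a pivot
      \<open>s\<close>.\<close>
    show ?case
    proof (cases "\<exists>s K0. conic_rep I v A s K0 \<and> (\<forall>i\<in>I - insert i0 J. s i = 0) \<and> s i0 \<noteq> 0")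
      case False
      then show ?thesis using C IH by (intro exI[of _ C]) blast
    next
      case True
      then obtain s K0 where s: "conic_rep I v A s K0" "\<forall>i\<in>I - insert i0 J. s i = 0" "s i0 \<noteq> 0"
        by blast
      have K0: "0 \<le> K0" using s(1) by (rule conic_rep_nonneg)
      \<comment> \<open>\<open>f\<close> is split as \<open>g + \<kappa> * s\<close> with
        \<open>g\<close> vanishing at \<open>i0\<close>. The absolute coordinates of
        \<open>g\<close> sum to at most
        \<open>1 + (\<Sum>i\<in>I. \<bar>s i\<bar>) / \<bar>s i0\<bar>\<close> times those of
        \<open>f\<close>, and \<open>\<kappa> * s\<close> costs at most
        \<open>K0 / \<bar>s i0\<bar>\<close> times the same sum.\<close>
      define D where "D = C * (1 + (\<Sum>i\<in>I. \<bar>s i\<bar>) / \<bar>s i0\<bar>) + K0 / \<bar>s i0\<bar>"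
      show ?thesis
      proof (intro exI[of _ D] conjI allI impI)
        show "0 \<le> D" using C K0 by (auto simp: D_def intro!: add_nonneg_nonneg mult_nonneg_nonneg sum_nonneg)
        fix f K assume f: "conic_rep I v A f K" "\<forall>i\<in>I - insert i0 J. f i = 0"
        define \<kappa> where "\<kappa> = f i0 / s i0"
        define g where "g i = f i + (- \<kappa>) * s i" for i
        have "conic_rep I v A g (K + \<bar>- \<kappa>\<bar> * K0)"
          unfolding g_def by (intro conic_rep_add conic_rep_mult sym f s)
        moreover have "\<forall>i\<in>I - J. g i = 0" 
        proof
          fix i assume "i \<in> I - J"
          then show "g i = 0" using f(2) s(2,3) by (cases "i = i0") (auto simp: g_def \<kappa>_def)
        qed
        ultimately have "conic_rep I v A g (C * (\<Sum>i\<in>I. \<bar>g i\<bar>))" by (rule IH)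
        then have 1: "conic_rep I v A (\<lambda>i. g i + \<kappa> * s i) (C * (\<Sum>i\<in>I. \<bar>g i\<bar>) + \<bar>\<kappa>\<bar> * K0)"
          by (intro conic_rep_add conic_rep_mult sym s)
        have "(\<Sum>i\<in>I. \<bar>g i\<bar>) \<le> (\<Sum>i\<in>I. \<bar>f i\<bar> + \<bar>\<kappa>\<bar> * \<bar>s i\<bar>)"
          by (rule sum_mono) (auto simp: g_def simp flip: abs_mult)
        then have 2: "(\<Sum>i\<in>I. \<bar>g i\<bar>) \<le> (\<Sum>i\<in>I. \<bar>f i\<bar>) + \<bar>\<kappa>\<bar> * (\<Sum>i\<in>I. \<bar>s i\<bar>)"
          by (simp add: sum.distrib sum_distrib_left)
        have "\<bar>f i0\<bar> \<le> (\<Sum>i\<in>I. \<bar>f i\<bar>)"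
          using insert.prems assms(1) by (intro member_le_sum) auto
        then have 3: "\<bar>\<kappa>\<bar> \<le> (\<Sum>i\<in>I. \<bar>f i\<bar>) / \<bar>s i0\<bar>"
          by (simp add: \<kappa>_def divide_right_mono)
        have "C * (\<Sum>i\<in>I. \<bar>g i\<bar>) + \<bar>\<kappa>\<bar> * K0
           \<le> C * ((\<Sum>i\<in>I. \<bar>f i\<bar>) + (\<Sum>i\<in>I. \<bar>f i\<bar>) / \<bar>s i0\<bar> * (\<Sum>i\<in>I. \<bar>s i\<bar>)) + (\<Sum>i\<in>I. \<bar>f i\<bar>) / \<bar>s i0\<bar> * K0"
          using C K0 3 by (intro add_mono mult_left_mono mult_right_mono order_trans[OF 2]) (auto intro: sum_nonneg)
        also have "\<dots> = D * (\<Sum>i\<in>I. \<bar>f i\<bar>)" by (simp add: D_def algebra_simps)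
        finally show "conic_rep I v A f (D * (\<Sum>i\<in>I. \<bar>f i\<bar>))"
          by (rule conic_rep_mono[OF 1]) (simp add: g_def)
      qed
    qed
  qed
  from this[of I] assms(1) show ?thesis by simp
qed

text \<open>Bolzano-Weierstrass, one coordinate at a time because the index set is not a
  type.\<close>

lemma bounded_convergent_subseq:
  fixes g :: "nat \<Rightarrow> 'j \<Rightarrow> real"
  assumes "finite J" "\<And>j. j \<in> J \<Longrightarrow> bounded (range (\<lambda>k. g k j))"
  shows "\<exists>r l. strict_mono r \<and> (\<forall>j\<in>J. (\<lambda>k. g (r k) j) \<longlonglongrightarrow> l j)"
  using assms
proof (induction J rule: finite_induct)
  case empty
  show ?case by (intro exI[of _ id]) (auto simp: strict_mono_def)
next
  case (insert j0 J)
  then obtain r l where r: "strict_mono r" "\<forall>j\<in>J. (\<lambda>k. g (r k) j) \<longlonglongrightarrow> l j" by auto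
  have "bounded (range (\<lambda>k. g (r k) j0))"
    by (rule bounded_subset[OF insert.prems[of j0]]) auto
  then obtain l0 q where q: "strict_mono q" "((\<lambda>k. g (r k) j0) \<circ> q) \<longlonglongrightarrow> l0"
    using bounded_imp_convergent_subsequence by blast
  have "(\<lambda>k. g ((r \<circ> q) k) j) \<longlonglongrightarrow> (l(j0 := l0)) j" if "j \<in> insert j0 J" for j
  proof (cases "j = j0")
    case True
    then show ?thesis using q by (simp add: o_def)
  next
    case False
    then have "((\<lambda>k. g (r k) j) \<circ> q) \<longlonglongrightarrow> l j"
      using r that q(1) by (intro LIMSEQ_subseq_LIMSEQ) auto
    then show ?thesis using False by (simp add: o_def)
  qed
  with strict_mono_o[OF r(1) q(1)] show ?case by blast
qed

text \<open>With the number of summands fixed, only finitely many real sequences occur: the weights,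
  bounded because they are nonnegative with total at most \<open>K k\<close>, the coordinates of the
  atoms, and \<open>K\<close> itself. A common subsequence makes them all converge.\<close>

lemma conic_rep_limit:
  fixes v :: "'t \<Rightarrow> 'i \<Rightarrow> real" and K :: "nat \<Rightarrow> real"
  assumes "finite I" "A \<noteq> {}"
    and bdd: "\<And>i. i \<in> I \<Longrightarrow> bounded ((\<lambda>t. v t i) ` A)"
    and closed: "\<And>t l. (\<And>k. t k \<in> A) \<Longrightarrow> (\<And>i. i \<in> I \<Longrightarrow> (\<lambda>k::nat. v (t k) i) \<longlonglongrightarrow> l i) \<Longrightarrow>
        \<exists>s\<in>A. \<forall>i\<in>I. v s i = l i"
    and rep: "\<And>k. conic_rep I v A (f k) (K k)" and K: "bounded (range K)"
  shows "\<exists>r g L. strict_mono r \<and> conic_rep I v A g L \<and> (\<lambda>k. K (r k)) \<longlonglongrightarrow> L \<and>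
           (\<forall>i\<in>I. (\<lambda>k. f (r k) i) \<longlonglongrightarrow> g i)"
proof -
  define D where "D = {1..card I}"
  have finD: "finite D" by (simp add: D_def)
  define Q where "Q k t a \<longleftrightarrow> (\<forall>m. t m \<in> A) \<and> (\<forall>m. 0 \<le> a m) \<and> sum a D \<le> K k \<and>
      (\<forall>i\<in>I. f k i = (\<Sum>m\<in>D. a m * v (t m) i))" for k t a
  have "\<forall>k. \<exists>t a. Q k t a"
    unfolding Q_def D_def using conic_rep_indexed[OF assms(1) rep assms(2)] by blast
  then obtain t a where ta: "\<And>k. Q k (t k) (a k)" by metis
  have t: "t k m \<in> A" and a: "0 \<le> a k m" "(\<Sum>m\<in>D. a k m) \<le> K k"
    and f: "i \<in> I \<Longrightarrow> f k i = (\<Sum>m\<in>D. a k m * v (t k m) i)" for k m i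
    using ta[of k] by (auto simp: Q_def)
  obtain B where B: "\<And>k. \<bar>K k\<bar> \<le> B" using K by (auto simp: bounded_iff)
  have "bounded (range (\<lambda>k. a k m))" if "m \<in> D" for m
  proof -
    have "\<bar>a k m\<bar> \<le> B" for k
    proof -
      have "a k m \<le> (\<Sum>m\<in>D. a k m)" using that a finD by (intro member_le_sum) auto
      then show ?thesis using a(1)[of k m] a(2)[of k] B[of k] by linarith
    qed
    then show ?thesis by (auto simp: bounded_iff)
  qed
  then obtain r1 l1 where r1: "strict_mono r1" "\<And>m. m \<in> D \<Longrightarrow> (\<lambda>k. a (r1 k) m) \<longlonglongrightarrow> l1 m"
    using bounded_convergent_subseq[OF finD, of a] by blast
  \<comment> \<open>There is no topology on \<open>'t\<close>: coordinates are made to converge, not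
    the atoms, and \<open>closed\<close> later supplies atoms with the limiting coordinates.\<close>
  have "bounded (range (\<lambda>k. v (t (r1 k) (fst p)) (snd p)))" if "p \<in> D \<times> I" for p
  proof (rule bounded_subset)
    show "bounded ((\<lambda>s. v s (snd p)) ` A)" using bdd[of "snd p"] that by auto
    show "range (\<lambda>k. v (t (r1 k) (fst p)) (snd p)) \<subseteq> (\<lambda>s. v s (snd p)) ` A" using t by blast
  qed
  from bounded_convergent_subseq[OF finite_cartesian_product[OF finD assms(1)], of "\<lambda>k p. v (t (r1 k) (fst p)) (snd p)", OF this]
  obtain r2 l2 where r2: "strict_mono r2"
    "\<And>p. p \<in> D \<times> I \<Longrightarrow> (\<lambda>k. v (t (r1 (r2 k)) (fst p)) (snd p)) \<longlonglongrightarrow> l2 p"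
    by blast
  have "bounded (range (\<lambda>k. K (r1 (r2 k))))" by (rule bounded_subset[OF K]) auto
  then obtain L r3 where r3: "strict_mono r3" "((\<lambda>k. K (r1 (r2 k))) \<circ> r3) \<longlonglongrightarrow> L"
    using bounded_imp_convergent_subsequence by blast
  define r where "r = r1 \<circ> (r2 \<circ> r3)"
  have r: "strict_mono r" unfolding r_def by (intro strict_mono_o r1 r2 r3)
  have lima: "(\<lambda>k. a (r k) m) \<longlonglongrightarrow> l1 m" if "m \<in> D" for m
    using LIMSEQ_subseq_LIMSEQ[OF r1(2)[OF that] strict_mono_o[OF r2(1) r3(1)]]
    by (simp add: o_def r_def)
  have limv: "(\<lambda>k. v (t (r k) m) i) \<longlonglongrightarrow> l2 (m, i)" if "m \<in> D" "i \<in> I" for m i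
    using LIMSEQ_subseq_LIMSEQ[OF r2(2)[of "(m, i)"] r3(1)] that
    by (simp add: o_def r_def)
  have limK: "(\<lambda>k. K (r k)) \<longlonglongrightarrow> L" using r3(2) by (simp add: o_def r_def)
  have "\<exists>s\<in>A. \<forall>i\<in>I. v s i = l2 (m, i)" if "m \<in> D" for m
    by (rule closed[of "\<lambda>k. t (r k) m"]) (use t limv that in blast)+
  then have "\<forall>m\<in>D. \<exists>s. s \<in> A \<and> (\<forall>i\<in>I. v s i = l2 (m, i))" by blast
  from bchoice[OF this] obtain s where "\<forall>m\<in>D. s m \<in> A \<and> (\<forall>i\<in>I. v (s m) i = l2 (m, i))"
    by blast
  then have s: "\<And>m. m \<in> D \<Longrightarrow> s m \<in> A"
      "\<And>m i. m \<in> D \<Longrightarrow> i \<in> I \<Longrightarrow> v (s m) i = l2 (m, i)" by blast+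
  define g where "g i = (\<Sum>m\<in>D. l1 m * v (s m) i)" for i
  have l1: "0 \<le> l1 m" if "m \<in> D" for m
    using lima[OF that] by (rule LIMSEQ_le_const) (use a(1) in blast)
  have "(\<lambda>k. \<Sum>m\<in>D. a (r k) m) \<longlonglongrightarrow> sum l1 D" by (intro tendsto_sum lima)
  then have "sum l1 D \<le> L" by (rule LIMSEQ_le[OF _ limK]) (use a(2) in blast)
  moreover have "conic_rep I v A g (\<Sum>m\<in>D. l1 m * 1)"
    unfolding g_def using l1 s finD by (intro conic_rep_sum conic_rep_scale conic_rep_atom) auto
  ultimately have "conic_rep I v A g L" using conic_rep_mono[of I v A g _ L g] by simp
  moreover have "(\<lambda>k. f (r k) i) \<longlonglongrightarrow> g i" if "i \<in> I" for i
    unfolding f[OF that] g_def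
  proof (rule tendsto_sum)
    fix m assume m: "m \<in> D"
    have "(\<lambda>k. v (t (r k) m) i) \<longlonglongrightarrow> v (s m) i"
      using limv[OF m that] s(2)[OF m that] by simp
    then show "(\<lambda>k. a (r k) m * v (t (r k) m) i) \<longlonglongrightarrow> l1 m * v (s m) i"
      by (rule tendsto_mult[OF lima[OF m]])
  qed
  ultimately show ?thesis
    using r limK by (intro exI[of _ r] exI[of _ g] exI[of _ L] conjI ballI)
qed

section \<open>Integration against vector measures\<close>

abbreviation mass :: "('w::topological_space set \<Rightarrow> 'u::real_normed_vector) \<Rightarrow> real" where
  "mass \<mu> \<equiv> enn2real (total_variation \<mu> UNIV)"

section \<open>Finite additivity, simple integrals and their limits\<close>

lemma vv_empty:
  assumes "vv_countably_additive \<mu>"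
  shows "\<mu> {} = 0"
proof -
  have "(\<lambda>i::nat. \<mu> {}) sums \<mu> {}"
    using assms[unfolded vv_countably_additive_def, rule_format, of "\<lambda>_. {}"]
    by (simp add: disjoint_family_on_def)
  then have "(\<lambda>i::nat. \<mu> {}) \<longlonglongrightarrow> 0"
    using sums_summable summable_LIMSEQ_zero by blast
  then show ?thesis by (simp add: LIMSEQ_const_iff)
qed

lemma vv_Un:
  assumes "vv_countably_additive \<mu>" "A \<in> sets borel" "B \<in> sets borel" "A \<inter> B = {}"
  shows "\<mu> (A \<union> B) = \<mu> A + \<mu> B"
proof -
  have "range (binaryset A B) \<subseteq> sets borel" using assms(2,3) by (simp add: range_binaryset_eq)
  moreover have "disjoint_family (binaryset A B)"
    using assms(4) by (auto simp: disjoint_family_on_def binaryset_def)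
  ultimately have "(\<lambda>i. \<mu> (binaryset A B i)) sums \<mu> (\<Union>i. binaryset A B i)"
    using assms(1) unfolding vv_countably_additive_def by blast
  then have "(\<lambda>i. \<mu> (binaryset A B i)) sums \<mu> (A \<union> B)" by (simp add: UN_binaryset_eq)
  moreover have "(\<lambda>i. \<mu> (binaryset A B i)) sums (\<mu> A + \<mu> B)"
    by (rule binaryset_sums) (rule vv_empty[OF assms(1)])
  ultimately show ?thesis by (rule sums_unique2)
qed

lemma vv_Union:
  assumes "vv_countably_additive \<mu>" "finite P" "P \<subseteq> sets borel" "disjoint P"
  shows "\<mu> (\<Union>P) = sum \<mu> P"
  using assms(2-4)
proof (induction P rule: finite_induct)
  case empty
  show ?case by (simp add: vv_empty[OF assms(1)])
next
  case (insert A P)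
  have "A \<inter> \<Union>P = {}" using insert.prems(2) insert.hyps(2) by (auto simp: disjoint_def)
  moreover have "disjoint P" using insert.prems(2) by (rule pairwise_subset) auto
  ultimately show ?case
    using insert vv_Un[OF assms(1), of A "\<Union>P"] by (auto simp: sets.finite_Union)
qed

lemma sum_norm_le_mass:
  assumes "total_variation \<mu> UNIV < \<infinity>" "finite P" "P \<subseteq> sets borel" "partition_on UNIV P"
  shows "(\<Sum>A\<in>P. norm (\<mu> A)) \<le> mass \<mu>"
proof -
  have "(\<Sum>A\<in>P. ennreal (norm (\<mu> A))) \<le> total_variation \<mu> UNIV"
    unfolding total_variation_def by (rule SUP_upper) (use assms in simp)
  then have "ennreal (\<Sum>A\<in>P. norm (\<mu> A)) \<le> total_variation \<mu> UNIV" by simp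
  then have "enn2real (ennreal (\<Sum>A\<in>P. norm (\<mu> A))) \<le> mass \<mu>"
    by (rule enn2real_mono) (use assms(1) in simp)
  then show ?thesis by (simp add: sum_nonneg)
qed

text \<open>The nonempty fibres of the joint map \<open>g\<close> do this: finitely many because
  each \<open>s j\<close> has finite range, Borel because each fibre is a finite intersection of
  level sets.\<close>

lemma common_partition:
  fixes s :: "'j \<Rightarrow> 'w::topological_space \<Rightarrow> real"
  assumes "finite J" "\<And>j. j \<in> J \<Longrightarrow> simple_function borel (s j)"
  shows "\<exists>P. finite P \<and> P \<subseteq> sets borel \<and> partition_on UNIV P \<and>
           (\<forall>A\<in>P. \<forall>w\<in>A. \<forall>w'\<in>A. \<forall>j\<in>J. s j w = s j w')"
proof -
  define g where "g w = restrict (\<lambda>j. s j w) J" for w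
  define P where "P = (\<lambda>b. g -` {b}) ` range g"
  have geq: "g w = g w' \<longleftrightarrow> (\<forall>j\<in>J. s j w = s j w')" for w w'
    by (auto simp: g_def restrict_def fun_eq_iff)
  have "range g \<subseteq> PiE J (\<lambda>j. range (s j))" by (auto simp: g_def)
  moreover have "finite (PiE J (\<lambda>j. range (s j)))"
    using simple_functionD(1)[OF assms(2)] assms(1) by (intro finite_PiE) auto
  ultimately have "finite P" unfolding P_def using finite_subset by blast
  moreover have "P \<subseteq> sets borel"
  proof
    fix A assume "A \<in> P"
    then obtain w where "A = g -` {g w}" by (auto simp: P_def)
    then have A: "A = {w'. \<forall>j\<in>J. s j w' = s j w}" by (auto simp: geq)
    have "{w' \<in> space borel. \<forall>j\<in>J. s j w' = s j w} \<in> sets borel"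
    proof (rule sets.sets_Collect_finite_All[OF _ assms(1)])
      fix j assume "j \<in> J"
      from simple_functionD(2)[OF assms(2)[OF this], of "{s j w}"]
      show "{w' \<in> space borel. s j w' = s j w} \<in> sets borel"
        by (simp add: vimage_def)
    qed
    then show "A \<in> sets borel" by (simp add: A)
  qed
  moreover have "partition_on UNIV P" by (auto simp: partition_on_def P_def disjoint_def)
  moreover have "\<forall>A\<in>P. \<forall>w\<in>A. \<forall>w'\<in>A. \<forall>j\<in>J. s j w = s j w'"
    by (auto simp: P_def geq)
  ultimately show ?thesis by blast
qed

text \<open>A level set of \<open>s\<close> is the union of the pieces with that value of
  \<open>h\<close>, so finite additivity regroups the sum. Integrals of several simple functions can
  thus be written over one partition.\<close>

lemma vv_simple_integral_partition:
  fixes \<mu> :: "'w::topological_space set \<Rightarrow> 'u::real_normed_vector"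
  assumes "vv_countably_additive \<mu>" "simple_function borel s"
    and P: "finite P" "P \<subseteq> sets borel" "partition_on UNIV P"
    and h: "\<And>A w. A \<in> P \<Longrightarrow> w \<in> A \<Longrightarrow> s w = h A"
  shows "vv_simple_integral \<mu> s = (\<Sum>A\<in>P. h A *\<^sub>R \<mu> A)"
proof -
  have UP: "\<Union>P = UNIV" and dP: "disjoint P" and neP: "{} \<notin> P"
    using P(3) by (auto simp: partition_on_def)
  have "s -` {c} = \<Union>{A\<in>P. h A = c}" for c
  proof (intro equalityI subsetI)
    fix w assume w: "w \<in> s -` {c}"
    have "w \<in> \<Union>P" using UP by simp
    then obtain A where A: "A \<in> P" "w \<in> A" by blast
    with h[OF this] w have "h A = c" by simp
    with A show "w \<in> \<Union>{A\<in>P. h A = c}" by blast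
  next
    fix w assume "w \<in> \<Union>{A\<in>P. h A = c}"
    then obtain A where A: "A \<in> P" "w \<in> A" "h A = c" by blast
    with h[OF A(1,2)] show "w \<in> s -` {c}" by simp
  qed
  moreover have "\<mu> (\<Union>{A\<in>P. h A = c}) = (\<Sum>A\<in>{A\<in>P. h A = c}. \<mu> A)" for c
  proof (rule vv_Union[OF assms(1)])
    show "disjoint {A\<in>P. h A = c}" by (rule pairwise_subset[OF dP]) auto
  qed (use P in auto)
  ultimately have "vv_simple_integral \<mu> s = (\<Sum>c\<in>range s. c *\<^sub>R (\<Sum>A\<in>{A\<in>P. h A = c}. \<mu> A))"
    by (simp add: vv_simple_integral_def)
  also have "\<dots> = (\<Sum>c\<in>range s. \<Sum>A\<in>{A\<in>P. h A = c}. h A *\<^sub>R \<mu> A)"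
    by (simp add: scaleR_sum_right)
  also have "\<dots> = (\<Sum>A\<in>P. h A *\<^sub>R \<mu> A)"
  proof (rule sum.group)
    show "finite (range s)" using simple_functionD(1)[OF assms(2)] by simp
    show "h ` P \<subseteq> range s"
    proof
      fix c assume "c \<in> h ` P"
      then obtain A where A: "A \<in> P" "c = h A" by blast
      then obtain w where "w \<in> A" using neP by (metis ex_in_conv)
      then show "c \<in> range s" using h[of A w] A by (metis rangeI)
    qed
  qed (rule P(1))
  finally show ?thesis .
qed

text \<open>Over a common partition the difference is a single sum with coefficients at most
  \<open>\<delta>\<close> in absolute value, and the variation bounds the rest.\<close>

lemma vv_simple_integral_diff_le:
  fixes \<mu> :: "'w::topological_space set \<Rightarrow> 'u::real_normed_vector"
  assumes \<mu>: "\<mu> \<in> vv_measures" and s: "simple_function borel s" and t: "simple_function borel t"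
    and le: "\<And>w. \<bar>s w - t w\<bar> \<le> \<delta>"
  shows "norm (vv_simple_integral \<mu> s - vv_simple_integral \<mu> t) \<le> \<delta> * mass \<mu>"
proof -
  have ca: "vv_countably_additive \<mu>" and tv: "total_variation \<mu> UNIV < \<infinity>"
    using \<mu> by (auto simp: vv_measures_def)
  \<comment> \<open>The two functions form a family indexed by \<open>bool\<close>, to which
    \<open>common_partition\<close> applies.\<close>
  define q where "q j = (if j then s else t)" for j
  have "simple_function borel (q j)" for j using s t by (cases j) (simp_all add: q_def)
  from common_partition[of "UNIV :: bool set" q, OF finite this] obtain P where
    P: "finite P" "P \<subseteq> sets borel" "partition_on UNIV P"
    and const: "\<forall>A\<in>P. \<forall>w\<in>A. \<forall>w'\<in>A. \<forall>j\<in>UNIV. q j w = q j w'"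
    by blast
  define p where "p A = (SOME w. w \<in> A)" for A :: "'w set"
  have p: "p A \<in> A" if "A \<in> P" for A
    using that P(3) unfolding p_def partition_on_def by (metis some_in_eq)
  have q_p: "q j w = q j (p A)" if "A \<in> P" "w \<in> A" for A w j
    using const that p[OF that(1)] by blast
  have s_p: "s w = s (p A)" and t_p: "t w = t (p A)" if "A \<in> P" "w \<in> A" for A w
    using q_p[OF that, of True] q_p[OF that, of False] by (simp_all add: q_def)
  have "vv_simple_integral \<mu> s - vv_simple_integral \<mu> t = (\<Sum>A\<in>P. (s (p A) - t (p A)) *\<^sub>R \<mu> A)"
    using vv_simple_integral_partition[OF ca s P s_p] vv_simple_integral_partition[OF ca t P t_p]
    by (simp add: scaleR_diff_left sum_subtractf)
  also have "norm \<dots> \<le> (\<Sum>A\<in>P. \<delta> * norm (\<mu> A))"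
    by (rule sum_norm_le) (simp add: mult_right_mono le)
  also have "\<dots> = \<delta> * (\<Sum>A\<in>P. norm (\<mu> A))" by (simp add: sum_distrib_left)
  also have "\<dots> \<le> \<delta> * mass \<mu>"
    using le[of undefined] by (intro mult_left_mono sum_norm_le_mass tv P) auto
  finally show ?thesis .
qed

text \<open>Two approximating sequences are compared so that one estimate serves twice: different
  ones give uniqueness of the integral, equal ones the Cauchy property.\<close>

lemma vv_simple_integral_uniform:
  fixes \<mu> :: "'w::topological_space set \<Rightarrow> 'u::real_normed_vector"
  assumes \<mu>: "\<mu> \<in> vv_measures"
    and s: "\<And>n. simple_function borel (s n)" "uniform_limit UNIV s f sequentially"
    and t: "\<And>n. simple_function borel (t n)" "uniform_limit UNIV t f sequentially"
    and "0 < e"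
  shows "\<exists>N::nat. \<forall>m\<ge>N. \<forall>n\<ge>N. norm (vv_simple_integral \<mu> (s m) - vv_simple_integral \<mu> (t n)) < e"
proof -
  \<comment> \<open>The added 1 keeps \<open>K\<close> positive for the zero measure, since
    \<open>\<delta>\<close> divides by it.\<close>
  define K where "K = mass \<mu> + 1"
  have K: "0 < K" unfolding K_def by (rule add_nonneg_pos) simp_all
  define \<delta> where "\<delta> = e / (2 * K)"
  have \<delta>: "0 < \<delta>"
    unfolding \<delta>_def using K \<open>0 < e\<close> by simp
  obtain N1 where N1: "\<And>n w. N1 \<le> n \<Longrightarrow> dist (s n w) (f w) < \<delta>"
    using uniform_limitD[OF s(2) \<delta>] by (auto simp: eventually_sequentially)
  obtain N2 where N2: "\<And>n w. N2 \<le> n \<Longrightarrow> dist (t n w) (f w) < \<delta>"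
    using uniform_limitD[OF t(2) \<delta>] by (auto simp: eventually_sequentially)
  have "norm (vv_simple_integral \<mu> (s m) - vv_simple_integral \<mu> (t n)) < e"
    if "max N1 N2 \<le> m" "max N1 N2 \<le> n" for m n
  proof -
    have "\<bar>s m w - t n w\<bar> \<le> 2 * \<delta>" for w
      using N1[of m w] N2[of n w] that by (simp add: dist_real_def)
    then have "norm (vv_simple_integral \<mu> (s m) - vv_simple_integral \<mu> (t n)) \<le> 2 * \<delta> * mass \<mu>"
      by (rule vv_simple_integral_diff_le[OF \<mu> s(1) t(1)])
    also have "\<dots> < 2 * \<delta> * K" using \<delta> by (simp add: K_def)
    also have "\<dots> = e" using K by (simp add: \<delta>_def)
    finally show ?thesis .
  qed
  then show ?thesis by blast
qed

lemma has_vv_integral_unique: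
  assumes \<mu>: "\<mu> \<in> vv_measures" and "has_vv_integral \<mu> f a" "has_vv_integral \<mu> f b"
  shows "a = b"
proof -
  from assms(2) obtain s where s: "\<And>n. simple_function borel (s n)"
    "uniform_limit UNIV s f sequentially" "(\<lambda>n. vv_simple_integral \<mu> (s n)) \<longlonglongrightarrow> a"
    unfolding has_vv_integral_def by blast
  from assms(3) obtain t where t: "\<And>n. simple_function borel (t n)"
    "uniform_limit UNIV t f sequentially" "(\<lambda>n. vv_simple_integral \<mu> (t n)) \<longlonglongrightarrow> b"
    unfolding has_vv_integral_def by blast
  have lim: "(\<lambda>n. vv_simple_integral \<mu> (s n) - vv_simple_integral \<mu> (t n)) \<longlonglongrightarrow> a - b"
    by (intro tendsto_diff s t)
  have "(\<lambda>n. vv_simple_integral \<mu> (s n) - vv_simple_integral \<mu> (t n)) \<longlonglongrightarrow> 0"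
  proof (rule LIMSEQ_I)
    fix e :: real assume "0 < e"
    from vv_simple_integral_uniform[OF \<mu> s(1,2) t(1,2) this]
    show "\<exists>N. \<forall>n\<ge>N. norm (vv_simple_integral \<mu> (s n) - vv_simple_integral \<mu> (t n) - 0) < e"
      by auto
  qed
  with lim have "a - b = 0" by (rule LIMSEQ_unique)
  then show ?thesis by simp
qed

lemma has_vv_integral_imp_vv_integral:
  assumes "\<mu> \<in> vv_measures" "has_vv_integral \<mu> f I"
  shows "vv_integral \<mu> f = I"
  unfolding vv_integral_def
  using assms(2) by (rule the_equality) (rule has_vv_integral_unique[OF assms(1) _ assms(2)])

text \<open>Rounding down to a grid of mesh \<open>1 / Suc n\<close> moves \<open>f\<close> by at
  most the mesh, and boundedness leaves only finitely many grid values.\<close>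

lemma uniform_simple_approximation:
  fixes f :: "'w::topological_space \<Rightarrow> real"
  assumes [measurable]: "f \<in> borel_measurable borel" and B: "\<And>w. \<bar>f w\<bar> \<le> B"
  shows "\<exists>s. (\<forall>n::nat. simple_function borel (s n)) \<and> uniform_limit UNIV s f sequentially"
proof -
  define s where "s n w = real_of_int \<lfloor>f w * real (Suc n)\<rfloor> / real (Suc n)" for n w
  have "simple_function borel (s n)" for n
  proof (rule simple_function_borel_measurable)
    show "s n \<in> borel_measurable borel" unfolding s_def by measurable
    have "\<lfloor>f w * real (Suc n)\<rfloor> \<in> {\<lfloor>- (B * real (Suc n))\<rfloor>..\<lfloor>B * real (Suc n)\<rfloor>}" for w
    proof -
      have "\<bar>f w * real (Suc n)\<bar> \<le> B * real (Suc n)"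
        using B[of w] by (simp add: abs_mult mult_right_mono)
      then have "- (B * real (Suc n)) \<le> f w * real (Suc n)" "f w * real (Suc n) \<le> B * real (Suc n)"
        by linarith+
      then show ?thesis by (simp only: atLeastAtMost_iff floor_mono)
    qed
    then have "s n ` UNIV \<subseteq> (\<lambda>i. real_of_int i / real (Suc n)) `
        {\<lfloor>- (B * real (Suc n))\<rfloor>..\<lfloor>B * real (Suc n)\<rfloor>}"
      unfolding s_def by blast
    then show "finite (s n ` space borel)" using finite_subset by auto
  qed
  moreover have "uniform_limit UNIV s f sequentially"
  proof (rule uniform_limitI)
    fix e :: real assume "0 < e"
    then obtain N where N: "inverse (real (Suc N)) < e" using reals_Archimedean by blast
    have "dist (s n w) (f w) < e" if "N \<le> n" for n w
    proof -
      have "\<bar>real_of_int \<lfloor>f w * real (Suc n)\<rfloor> - f w * real (Suc n)\<bar> \<le> 1" by linarith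
      moreover have "s n w - f w = (real_of_int \<lfloor>f w * real (Suc n)\<rfloor> - f w * real (Suc n)) / real (Suc n)"
        by (simp add: s_def field_simps)
      ultimately have "dist (s n w) (f w) \<le> 1 / real (Suc n)"
        by (simp add: dist_real_def divide_right_mono del: of_nat_Suc)
      also have "\<dots> \<le> inverse (real (Suc N))" using that by (simp add: field_simps)
      finally show ?thesis using N by simp
    qed
    then show "\<forall>\<^sub>F n in sequentially. \<forall>w\<in>UNIV. dist (s n w) (f w) < e"
      by (auto simp: eventually_sequentially)
  qed
  ultimately show ?thesis by blast
qed

text \<open>Completeness of \<open>'u\<close> enters here, turning the Cauchy sequence of simple
  integrals into a convergent one.\<close>

lemma has_vv_integral_vv_integral:
  fixes \<mu> :: "'w::topological_space set \<Rightarrow> 'u::banach"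
  assumes \<mu>: "\<mu> \<in> vv_measures" and f: "f \<in> borel_measurable borel" "\<And>w. \<bar>f w\<bar> \<le> B"
  shows "has_vv_integral \<mu> f (vv_integral \<mu> f)"
proof -
  obtain s where s: "\<And>n::nat. simple_function borel (s n)" "uniform_limit UNIV s f sequentially"
    using uniform_simple_approximation[OF f] by blast
  have "Cauchy (\<lambda>n. vv_simple_integral \<mu> (s n))"
    by (rule CauchyI) (rule vv_simple_integral_uniform[OF \<mu> s s])
  then obtain I where "(\<lambda>n. vv_simple_integral \<mu> (s n)) \<longlonglongrightarrow> I"
    using Cauchy_convergent convergent_def by blast
  then have "has_vv_integral \<mu> f I" using s unfolding has_vv_integral_def by blast
  moreover from this have "vv_integral \<mu> f = I" by (rule has_vv_integral_imp_vv_integral[OF \<mu>])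
  ultimately show ?thesis by simp
qed

text \<open>All integrals are approximated by Riemann sums over the same pieces with the same sample
  points. The vector \<open>\<mu> A\<close> then multiplies every \<open>f j (p A)\<close>, so that
  each piece yields one atom for all data points together.\<close>

lemma vv_integrals_approximation:
  fixes \<mu> :: "'w::topological_space set \<Rightarrow> 'u::real_normed_vector"
  assumes \<mu>: "\<mu> \<in> vv_measures" and "finite J" and int: "\<And>j. j \<in> J \<Longrightarrow> has_vv_integral \<mu> (f j) (I j)"
    and "0 < e"
  shows "\<exists>P p. finite P \<and> (\<Sum>A\<in>P. norm (\<mu> A)) \<le> mass \<mu> \<and>
           (\<forall>j\<in>J. norm ((\<Sum>A\<in>P. f j (p A) *\<^sub>R \<mu> A) - I j) < e)"
proof -
  have ca: "vv_countably_additive \<mu>" and tv: "total_variation \<mu> UNIV < \<infinity>"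
    using \<mu> by (auto simp: vv_measures_def)
  define K where "K = mass \<mu> + 1"
  have K: "0 < K" unfolding K_def by (rule add_nonneg_pos) simp_all
  define \<delta> where "\<delta> = e / (2 * K)"
  have \<delta>: "0 < \<delta>"
    unfolding \<delta>_def using K \<open>0 < e\<close> by simp
  \<comment> \<open>Half of \<open>e\<close> goes to the simple integrals, half to replacing
    \<open>s j\<close> by \<open>f j\<close> at the sample points.\<close>
  have "\<forall>j\<in>J. \<exists>s. simple_function borel s \<and> (\<forall>w. \<bar>f j w - s w\<bar> \<le> \<delta>) \<and>
      norm (vv_simple_integral \<mu> s - I j) < e / 2"
  proof
    fix j assume "j \<in> J"
    from int[OF this] obtain s where s: "\<And>n. simple_function borel (s n)"
      "uniform_limit UNIV s (f j) sequentially" "(\<lambda>n. vv_simple_integral \<mu> (s n)) \<longlonglongrightarrow> I j"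
      unfolding has_vv_integral_def by blast
    obtain N1 where N1: "\<And>n w. N1 \<le> n \<Longrightarrow> dist (s n w) (f j w) < \<delta>"
      using uniform_limitD[OF s(2) \<delta>] by (auto simp: eventually_sequentially)
    obtain N2 where N2: "\<And>n. N2 \<le> n \<Longrightarrow> norm (vv_simple_integral \<mu> (s n) - I j) < e / 2"
      using LIMSEQ_D[OF s(3), of "e / 2"] \<open>0 < e\<close> by auto
    have "\<bar>f j w - s (max N1 N2) w\<bar> \<le> \<delta>" for w
      using N1[of "max N1 N2" w] by (simp add: dist_real_def abs_minus_commute)
    then show "\<exists>s. simple_function borel s \<and> (\<forall>w. \<bar>f j w - s w\<bar> \<le> \<delta>) \<and>
        norm (vv_simple_integral \<mu> s - I j) < e / 2"
      using s(1) N2[of "max N1 N2"] by (intro exI[of _ "s (max N1 N2)"]) simp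
  qed
  from bchoice[OF this] obtain s where s: "\<And>j. j \<in> J \<Longrightarrow> simple_function borel (s j)"
    "\<And>j w. j \<in> J \<Longrightarrow> \<bar>f j w - s j w\<bar> \<le> \<delta>"
    "\<And>j. j \<in> J \<Longrightarrow> norm (vv_simple_integral \<mu> (s j) - I j) < e / 2" by blast
  obtain P where P: "finite P" "P \<subseteq> sets borel" "partition_on UNIV P"
    and const: "\<forall>A\<in>P. \<forall>w\<in>A. \<forall>w'\<in>A. \<forall>j\<in>J. s j w = s j w'"
    using common_partition[of J s, OF assms(2) s(1)] by blast
  define p where "p A = (SOME w. w \<in> A)" for A :: "'w set"
  have p: "p A \<in> A" if "A \<in> P" for A
    using that P(3) unfolding p_def partition_on_def by (metis some_in_eq)
  have "norm ((\<Sum>A\<in>P. f j (p A) *\<^sub>R \<mu> A) - I j) < e" if j: "j \<in> J" for j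
  proof -
    have "s j w = s j (p A)" if "A \<in> P" "w \<in> A" for A w
      using const that p[OF that(1)] j by blast
    then have eq: "vv_simple_integral \<mu> (s j) = (\<Sum>A\<in>P. s j (p A) *\<^sub>R \<mu> A)"
      by (rule vv_simple_integral_partition[OF ca s(1)[OF j] P])
    have "norm ((\<Sum>A\<in>P. f j (p A) *\<^sub>R \<mu> A) - vv_simple_integral \<mu> (s j))
        = norm (\<Sum>A\<in>P. (f j (p A) - s j (p A)) *\<^sub>R \<mu> A)"
      by (simp add: eq scaleR_diff_left sum_subtractf)
    also have "\<dots> \<le> (\<Sum>A\<in>P. \<delta> * norm (\<mu> A))"
      by (rule sum_norm_le) (simp add: mult_right_mono s(2)[OF j])
    also have "\<dots> = \<delta> * (\<Sum>A\<in>P. norm (\<mu> A))" by (simp add: sum_distrib_left)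
    also have "\<dots> \<le> \<delta> * K"
      using sum_norm_le_mass[OF tv P] \<delta> by (intro mult_left_mono) (auto simp: K_def)
    also have "\<dots> = e / 2" using K by (simp add: \<delta>_def)
    finally have "norm ((\<Sum>A\<in>P. f j (p A) *\<^sub>R \<mu> A) - vv_simple_integral \<mu> (s j)) \<le> e / 2" .
    then show ?thesis
      using s(3)[OF j] norm_triangle_ineq[of "(\<Sum>A\<in>P. f j (p A) *\<^sub>R \<mu> A) - vv_simple_integral \<mu> (s j)"
        "vv_simple_integral \<mu> (s j) - I j"] by simp
  qed
  then show ?thesis using P(1) sum_norm_le_mass[OF tv P] by blast
qed

section \<open>Finite sums of Dirac measures\<close>

abbreviation (input) dirac_sum ::
    "'i set \<Rightarrow> ('i \<Rightarrow> real) \<Rightarrow> ('i \<Rightarrow> 'w) \<Rightarrow> ('i \<Rightarrow> 'u::real_normed_vector) \<Rightarrow> 'w set \<Rightarrow> 'u" where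
  "dirac_sum S a w u \<equiv> (\<lambda>E. \<Sum>i\<in>S. a i *\<^sub>R vv_dirac (w i) (u i) E)"

text \<open>Each location lies in at most one piece of a partition, so after exchanging the sums
  every summand counts at most once. Equality can fail because summands at the same location may
  cancel. Regularity needs the bound on sets other than \<open>UNIV\<close>.\<close>

lemma total_variation_dirac_sum_le:
  assumes "finite S"
  shows "total_variation (dirac_sum S a w u) E \<le>
    ennreal (\<Sum>i\<in>S. if w i \<in> E then \<bar>a i\<bar> * norm (u i) else 0)"
  unfolding total_variation_def
proof (rule SUP_least)
  fix P assume "P \<in> {P. finite P \<and> P \<subseteq> sets borel \<and> partition_on E P}"
  then have P: "finite P" "\<Union>P = E" "disjoint P" by (auto simp: partition_on_def)
  define c where "c i = \<bar>a i\<bar> * norm (u i)" for i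
  have one: "(\<Sum>A\<in>P. if w i \<in> A then c i else 0) = (if w i \<in> E then c i else 0)" for i
  proof (cases "w i \<in> E")
    case True
    then obtain B where B: "B \<in> P" "w i \<in> B" using P(2) by blast
    have "w i \<in> A \<longleftrightarrow> A = B" if "A \<in> P" for A
      using disjointD[OF P(3) that B(1)] B(2) by blast
    then have "(\<Sum>A\<in>P. if w i \<in> A then c i else 0) = (\<Sum>A\<in>P. if A = B then c i else 0)"
      by (intro sum.cong) auto
    then show ?thesis using P(1) B True by simp
  next
    case False
    then have "w i \<notin> A" if "A \<in> P" for A using that P(2) by blast
    then show ?thesis using False by simp
  qed
  have "(\<Sum>A\<in>P. norm (dirac_sum S a w u A)) \<le> (\<Sum>A\<in>P. \<Sum>i\<in>S. if w i \<in> A then c i else 0)"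
  proof (intro sum_mono sum_norm_le)
    fix A i
    show "norm (a i *\<^sub>R vv_dirac (w i) (u i) A) \<le> (if w i \<in> A then c i else 0)"
      by (simp add: vv_dirac_def c_def)
  qed
  also have "\<dots> = (\<Sum>i\<in>S. if w i \<in> E then c i else 0)"
    by (subst sum.swap) (simp only: one)
  finally have "ennreal (\<Sum>A\<in>P. norm (dirac_sum S a w u A)) \<le> ennreal (\<Sum>i\<in>S. if w i \<in> E then c i else 0)"
    by (rule ennreal_leI)
  then show "(\<Sum>A\<in>P. ennreal (norm (dirac_sum S a w u A)))
      \<le> ennreal (\<Sum>i\<in>S. if w i \<in> E then \<bar>a i\<bar> * norm (u i) else 0)"
    unfolding c_def by simp
qed

lemma mass_dirac_sum_le:
  assumes "finite S"
  shows "mass (dirac_sum S a w u) \<le> (\<Sum>i\<in>S. \<bar>a i\<bar> * norm (u i))"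
proof -
  have "total_variation (dirac_sum S a w u) UNIV \<le> ennreal (\<Sum>i\<in>S. \<bar>a i\<bar> * norm (u i))"
    using total_variation_dirac_sum_le[OF assms, of a w u UNIV] by simp
  then have "mass (dirac_sum S a w u) \<le> enn2real (ennreal (\<Sum>i\<in>S. \<bar>a i\<bar> * norm (u i)))"
    by (rule enn2real_mono) simp
  then show ?thesis by (simp add: sum_nonneg)
qed

lemma vv_dirac_sums:
  fixes A :: "nat \<Rightarrow> 'w set"
  assumes "disjoint_family A"
  shows "(\<lambda>n. vv_dirac w u (A n)) sums vv_dirac w u (\<Union>n. A n)"
proof (cases "w \<in> (\<Union>n. A n)")
  case True
  then obtain m where m: "w \<in> A m" by blast
  have "w \<in> A n \<longleftrightarrow> n = m" for n
    using assms m by (auto simp: disjoint_family_on_def)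
  then have "(\<lambda>n. vv_dirac w u (A n)) = (\<lambda>n. if n = m then u else 0)"
    by (simp add: vv_dirac_def fun_eq_iff)
  moreover have "(\<lambda>n. if n = m then u else 0) sums u" by (rule sums_single)
  ultimately show ?thesis using True by (simp add: vv_dirac_def)
next
  case False
  then have "(\<lambda>n. vv_dirac w u (A n)) = (\<lambda>n. 0)" by (auto simp: vv_dirac_def)
  then show ?thesis using False by (simp add: vv_dirac_def)
qed

lemma dirac_sum_in_vv_measures:
  fixes w :: "'i \<Rightarrow> 'w::t2_space"
  assumes "finite S"
  shows "dirac_sum S a w u \<in> vv_measures"
proof -
  have "vv_countably_additive (dirac_sum S a w u)"
    unfolding vv_countably_additive_def
    by (intro allI impI sums_sum sums_scaleR_right vv_dirac_sums)
  moreover have "total_variation (dirac_sum S a w u) UNIV < \<infinity>"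
    using total_variation_dirac_sum_le[OF assms, of a w u UNIV]
    by (rule order.strict_trans1) simp
  moreover have "vv_regular (dirac_sum S a w u)"
    unfolding vv_regular_def
  proof (intro ballI allI impI)
    fix E :: "'w set" and e :: real assume "0 < e"
    \<comment> \<open>\<open>K\<close> collects the locations inside \<open>E\<close> and
      \<open>G\<close> removes those outside, so \<open>G - K\<close> contains no location and has
      variation zero.\<close>
    define K where "K = w ` S \<inter> E"
    define G where "G = - (w ` S - E)"
    have "finite (w ` S)" using assms by simp
    then have "compact K" "open G"
      unfolding K_def G_def by (intro finite_imp_compact open_Compl finite_imp_closed finite_Int finite_Diff disjI1; assumption)+
    moreover have "K \<subseteq> E" "E \<subseteq> G" by (auto simp: K_def G_def)
    moreover have "total_variation (dirac_sum S a w u) (G - K) < ennreal e"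
    proof -
      have "w i \<notin> G - K" if "i \<in> S" for i using that by (auto simp: K_def G_def)
      then have "(\<Sum>i\<in>S. if w i \<in> G - K then \<bar>a i\<bar> * norm (u i) else 0) = 0"
        by (intro sum.neutral) auto
      then show ?thesis
        using total_variation_dirac_sum_le[OF assms, of a w u "G - K"] \<open>0 < e\<close> by simp
    qed
    ultimately show "\<exists>K G. compact K \<and> open G \<and> K \<subseteq> E \<and> E \<subseteq> G \<and>
        total_variation (dirac_sum S a w u) (G - K) < ennreal e" by blast
  qed
  ultimately show ?thesis by (simp add: vv_measures_def)
qed

lemma vv_integral_dirac_sum:
  fixes w :: "'i \<Rightarrow> 'w::t2_space" and u :: "'i \<Rightarrow> 'u::real_normed_vector"
  assumes "finite S" "f \<in> borel_measurable borel" "\<And>w. \<bar>f w\<bar> \<le> B"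
  shows "vv_integral (dirac_sum S a w u) f = (\<Sum>i\<in>S. (a i * f (w i)) *\<^sub>R u i)"
proof (rule has_vv_integral_imp_vv_integral[OF dirac_sum_in_vv_measures[OF assms(1)]])
  obtain s where s: "\<And>n::nat. simple_function borel (s n)" "uniform_limit UNIV s f sequentially"
    using uniform_simple_approximation[OF assms(2,3)] by blast
  have simple: "vv_simple_integral (dirac_sum S a w u) t = (\<Sum>i\<in>S. (a i * t (w i)) *\<^sub>R u i)"
    if t: "simple_function borel t" for t
  proof -
    have fin: "finite (range t)" using simple_functionD(1)[OF t] by simp
    \<comment> \<open>Among the level sets of \<open>t\<close>, only the one of the value
      \<open>t (w i)\<close> contains \<open>w i\<close>.\<close>
    have one: "(\<Sum>c\<in>range t. c *\<^sub>R a i *\<^sub>R vv_dirac (w i) (u i) (t -` {c})) = (a i * t (w i)) *\<^sub>R u i" for i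
    proof -
      have "(\<Sum>c\<in>range t. c *\<^sub>R a i *\<^sub>R vv_dirac (w i) (u i) (t -` {c}))
          = (\<Sum>c\<in>range t. if c = t (w i) then (a i * t (w i)) *\<^sub>R u i else 0)"
        by (intro sum.cong) (auto simp: vv_dirac_def mult.commute)
      then show ?thesis using fin by simp
    qed
    have "vv_simple_integral (dirac_sum S a w u) t
        = (\<Sum>c\<in>range t. \<Sum>i\<in>S. c *\<^sub>R a i *\<^sub>R vv_dirac (w i) (u i) (t -` {c}))"
      by (simp only: vv_simple_integral_def scaleR_sum_right)
    also have "\<dots> = (\<Sum>i\<in>S. (a i * t (w i)) *\<^sub>R u i)"
      by (subst sum.swap) (simp only: one)
    finally show ?thesis .
  qed
  have "(\<lambda>n. s n z) \<longlonglongrightarrow> f z" for z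
    by (rule tendsto_uniform_limitI[OF s(2)]) simp
  then have "(\<lambda>n. \<Sum>i\<in>S. (a i * s n (w i)) *\<^sub>R u i) \<longlonglongrightarrow> (\<Sum>i\<in>S. (a i * f (w i)) *\<^sub>R u i)"
    by (intro tendsto_sum tendsto_scaleR tendsto_mult tendsto_const)
  then have "(\<lambda>n. vv_simple_integral (dirac_sum S a w u) (s n)) \<longlonglongrightarrow> (\<Sum>i\<in>S. (a i * f (w i)) *\<^sub>R u i)"
    by (simp only: simple[OF s(1)])
  then show "has_vv_integral (dirac_sum S a w u) f (\<Sum>i\<in>S. (a i * f (w i)) *\<^sub>R u i)"
    unfolding has_vv_integral_def using s by blast
qed

section \<open>Slices of the integrand and the norm of the function space\<close>

lemma
  fixes \<phi> :: "'x::t2_space \<times> 'w::t2_space \<Rightarrow> real"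
  assumes "\<phi> \<in> C0"
  shows C0_slice_continuous: "continuous_on UNIV (\<lambda>w. \<phi> (x, w))"
    and C0_slice_compact: "0 < e \<Longrightarrow> compact {w. e \<le> \<bar>\<phi> (x, w)\<bar>}"
    and C0_slice_bounded: "\<exists>B. \<forall>w. \<bar>\<phi> (x, w)\<bar> \<le> B"
proof -
  have cont: "continuous_on UNIV \<phi>" and comp: "\<And>e. 0 < e \<Longrightarrow> compact {p. e \<le> \<bar>\<phi> p\<bar>}"
    using assms by (auto simp: C0_def)
  show c: "continuous_on UNIV (\<lambda>w. \<phi> (x, w))"
    by (rule continuous_on_compose2[OF cont]) (auto intro!: continuous_intros)
  show k: "compact {w. e \<le> \<bar>\<phi> (x, w)\<bar>}" if "0 < e" for e
  proof -
    \<comment> \<open>A projection of a closed part of a compact set; \<open>{x}\<close> is closed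
      because \<open>'x\<close> is Hausdorff.\<close>
    have "{w. e \<le> \<bar>\<phi> (x, w)\<bar>} = snd ` ({p. e \<le> \<bar>\<phi> p\<bar>} \<inter> {x} \<times> UNIV)" by force
    moreover have "compact ({p. e \<le> \<bar>\<phi> p\<bar>} \<inter> {x} \<times> (UNIV :: 'w set))"
      by (intro compact_Int_closed comp that closed_Times) auto
    ultimately show ?thesis
      using compact_continuous_image[OF continuous_on_snd[OF continuous_on_id]] by simp
  qed
  have "bounded ((\<lambda>w. \<phi> (x, w)) ` {w. 1 \<le> \<bar>\<phi> (x, w)\<bar>})"
    by (rule compact_imp_bounded[OF compact_continuous_image[OF continuous_on_subset[OF c] k]]) auto
  then obtain B where B: "\<And>w. 1 \<le> \<bar>\<phi> (x, w)\<bar> \<Longrightarrow> \<bar>\<phi> (x, w)\<bar> \<le> B"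
    by (auto simp: bounded_iff)
  have "\<bar>\<phi> (x, w)\<bar> \<le> max 1 B" for w using B[of w] by (cases "1 \<le> \<bar>\<phi> (x, w)\<bar>") auto
  then show "\<exists>B. \<forall>w. \<bar>\<phi> (x, w)\<bar> \<le> B" by blast
qed

lemma C0_slice_borel:
  fixes \<phi> :: "'x::t2_space \<times> 'w::t2_space \<Rightarrow> real"
  assumes "\<phi> \<in> C0"
  shows "(\<lambda>w. \<phi> (x, w)) \<in> borel_measurable borel"
  by (rule borel_measurable_continuous_onI[OF C0_slice_continuous[OF assms]])

lemma has_vv_integral_rkbs_op:
  fixes \<phi> :: "'x::t2_space \<times> 'w::t2_space \<Rightarrow> real" and \<mu> :: "'w set \<Rightarrow> 'u::banach"
  assumes "\<phi> \<in> C0" "\<mu> \<in> vv_measures"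
  shows "has_vv_integral \<mu> (\<lambda>w. \<phi> (x, w)) (rkbs_op \<phi> \<mu> x)"
proof -
  obtain B where "\<And>w. \<bar>\<phi> (x, w)\<bar> \<le> B" using C0_slice_bounded[OF assms(1)] by blast
  then show ?thesis
    unfolding rkbs_op_def by (rule has_vv_integral_vv_integral[OF assms(2) C0_slice_borel[OF assms(1)]])
qed

lemma rkbs_op_dirac_sum:
  fixes \<phi> :: "'x::t2_space \<times> 'w::t2_space \<Rightarrow> real" and u :: "'i \<Rightarrow> 'u::real_normed_vector"
  assumes "\<phi> \<in> C0" "finite S"
  shows "rkbs_op \<phi> (dirac_sum S a w u) = (\<lambda>x. \<Sum>i\<in>S. (a i * \<phi> (x, w i)) *\<^sub>R u i)"
proof
  fix x
  obtain B where "\<And>w. \<bar>\<phi> (x, w)\<bar> \<le> B" using C0_slice_bounded[OF assms(1)] by blast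
  then show "rkbs_op \<phi> (dirac_sum S a w u) x = (\<Sum>i\<in>S. (a i * \<phi> (x, w i)) *\<^sub>R u i)"
    unfolding rkbs_op_def by (rule vv_integral_dirac_sum[OF assms(2) C0_slice_borel[OF assms(1)]])
qed

lemma
  fixes \<mu> :: "'w::topological_space set \<Rightarrow> 'u::real_normed_vector"
  shows rkbs_norm_le_mass: "\<mu> \<in> vv_measures \<Longrightarrow> rkbs_norm \<phi> (rkbs_op \<phi> \<mu>) \<le> mass \<mu>"
    and rkbs_norm_nonneg: "(f :: _ \<Rightarrow> 'u) \<in> rkbs \<phi> \<Longrightarrow> 0 \<le> rkbs_norm \<phi> f"
    and rkbs_norm_approx: "(f :: _ \<Rightarrow> 'u) \<in> rkbs \<phi> \<Longrightarrow> 0 < e \<Longrightarrow>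
      \<exists>\<mu>\<in>vv_measures. f = rkbs_op \<phi> \<mu> \<and> mass \<mu> < rkbs_norm \<phi> f + e"
proof -
  let ?M = "\<lambda>f :: _ \<Rightarrow> 'u. {mass \<mu> |\<mu>. \<mu> \<in> vv_measures \<and> f = rkbs_op \<phi> \<mu>}"
  have bdd: "bdd_below (?M f)" for f by (rule bdd_belowI[of _ 0]) auto
  show "rkbs_norm \<phi> (rkbs_op \<phi> \<mu>) \<le> mass \<mu>" if "\<mu> \<in> vv_measures"
    unfolding rkbs_norm_def by (rule cInf_lower[OF _ bdd]) (use that in blast)
  assume f: "f \<in> rkbs \<phi>"
  then have ne: "?M f \<noteq> {}" by (auto simp: rkbs_def)
  show "0 \<le> rkbs_norm \<phi> f"
    unfolding rkbs_norm_def by (rule cInf_greatest[OF ne]) auto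
  assume "0 < e"
  then have "Inf (?M f) < rkbs_norm \<phi> f + e" by (simp add: rkbs_norm_def)
  from cInf_lessD[OF ne this]
  show "\<exists>\<mu>\<in>vv_measures. f = rkbs_op \<phi> \<mu> \<and> mass \<mu> < rkbs_norm \<phi> f + e" by blast
qed

section \<open>Extreme points of the unit ball of a dual space\<close>

text \<open>The topology of \<open>'p => real\<close> is that of pointwise convergence, a product of
  Hausdorff spaces.\<close>

lemma compact_imp_closed_fun:
  fixes S :: "('p \<Rightarrow> real) set"
  assumes "compact S"
  shows "closed S"
proof -
  have "Hausdorff_space (product_topology (\<lambda>_::'p. euclidean :: real topology) UNIV)"
    by (simp add: Hausdorff_space_product_topology)
  then have "Hausdorff_space (euclidean :: ('p \<Rightarrow> real) topology)"
    by (simp only: euclidean_product_topology)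
  then show ?thesis
    using compactin_imp_closedin[of euclidean S] assms by simp
qed

text \<open>Banach-Alaoglu. Passing to functions on \<open>'p\<close> with pointwise convergence
  avoids putting a weak-* topology on \<open>'u\<close>. The image of the ball is a closed set of
  linear functions inside a product of intervals, compact by Tychonoff; surjectivity of
  \<open>J\<close> provides a preimage for each of them.\<close>

lemma compact_weak_star_unit_ball:
  fixes J :: "'u::real_normed_vector \<Rightarrow> 'p::real_normed_vector \<Rightarrow>\<^sub>L real"
  assumes "predual_identification J"
  shows "compact ((\<lambda>u. blinfun_apply (J u)) ` {u. norm u \<le> 1})"
proof -
  let ?box = "PiE UNIV (\<lambda>v::'p. {- norm v..norm v})"
  let ?lin = "{f :: 'p \<Rightarrow> real. \<forall>a b (r::real). f (a + b) = f a + f b \<and> f (r *\<^sub>R a) = r * f a}"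
  have J: "surj J" "\<And>u. norm (J u) = norm u"
    using assms by (auto simp: predual_identification_def)
  have "(\<lambda>u. blinfun_apply (J u)) ` {u. norm u \<le> 1} = ?box \<inter> ?lin"
  proof (intro equalityI subsetI)
    fix f assume "f \<in> (\<lambda>u. blinfun_apply (J u)) ` {u. norm u \<le> 1}"
    then obtain u where u: "norm u \<le> 1" "f = blinfun_apply (J u)" by blast
    have "\<bar>f v\<bar> \<le> norm v" for v
    proof -
      have "\<bar>f v\<bar> \<le> norm (J u) * norm v" using norm_blinfun[of "J u" v] u(2) by simp
      also have "\<dots> \<le> 1 * norm v" using u(1) J(2) by (intro mult_right_mono) auto
      finally show ?thesis by simp
    qed
    then have "f \<in> ?box" by (simp add: PiE_UNIV_domain abs_le_iff minus_le_iff)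
    moreover have "f \<in> ?lin" by (simp add: u(2) blinfun.add_right blinfun.scaleR_right)
    ultimately show "f \<in> ?box \<inter> ?lin" by blast
  next
    fix f assume f: "f \<in> ?box \<inter> ?lin"
    then have "f v \<in> {- norm v..norm v}" for v by (auto simp: PiE_def Pi_def)
    then have fb: "norm (f v) \<le> norm v * 1" for v
      using abs_le_iff[of "f v" "norm v"] minus_le_iff[of "f v"] by simp
    have "bounded_linear f"
      by (rule bounded_linear_intro[where K = 1]) (use f fb in auto)
    moreover obtain u where u: "J u = Blinfun f" using J(1) by (metis surjD)
    ultimately have "blinfun_apply (J u) = f" by (simp add: bounded_linear_Blinfun_apply)
    moreover have "norm (J u) \<le> 1"
      by (rule norm_blinfun_bound) (use fb calculation in auto)
    ultimately show "f \<in> (\<lambda>u. blinfun_apply (J u)) ` {u. norm u \<le> 1}"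
      using J(2) by (intro image_eqI[of _ _ u]) auto
  qed
  moreover have "compact ?box"
    using compactin_PiE[of "\<lambda>_. euclidean" UNIV "\<lambda>v::'p. {- norm v..norm v}"]
    by (simp add: euclidean_product_topology)
  moreover have "closed ?lin"
  proof -
    have eq: "?lin = (\<Inter>a b r. {f. f (a + b) = f a + f b} \<inter> {f. f (r *\<^sub>R a) = r * f a})" by auto
    show ?thesis
      unfolding eq
      by (intro closed_INT ballI closed_Int closed_Collect_eq continuous_on_add continuous_on_mult
          continuous_on_const continuous_on_product_coordinates)
  qed
  ultimately show ?thesis by (simp only: compact_Int_closed)
qed

text \<open>
  The Krein-Milman argument for the coarsest topology making all \<open>\<lambda>u. \<Phi> u v\<close> continuous: a minimal
  compact face is a singleton, because maximising some \<open>\<lambda>u. \<Phi> u v\<close> would cut out a smaller one.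
\<close>

lemma exists_extreme_point_of:
  fixes K :: "'u::real_vector set" and \<Phi> :: "'u \<Rightarrow> 'p \<Rightarrow> real"
  assumes "convex K" "K \<noteq> {}" "compact (\<Phi> ` K)" "inj \<Phi>"
    and lin: "\<And>v. linear (\<lambda>u. \<Phi> u v)"
  shows "\<exists>x. x extreme_point_of K"
proof -
  define A where "A = {F. F face_of K \<and> F \<noteq> {} \<and> compact (\<Phi> ` F)}"
  have "K \<in> A" using assms(1-3) by (simp add: A_def face_of_refl)
  have Inter: "\<Inter>D \<in> A" if D: "D \<subseteq> A" "D \<noteq> {}" and chain: "\<And>S T. S \<in> D \<Longrightarrow> T \<in> D \<Longrightarrow> S \<subseteq> T \<or> T \<subseteq> S" for D
  proof -
    obtain F0 where F0: "F0 \<in> D" using D(2) by blast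
    have comp: "compact (\<Phi> ` F)" and ne: "F \<noteq> {}" and face: "F face_of K" if "F \<in> D" for F
      using D(1) that by (auto simp: A_def)
    \<comment> \<open>Injectivity lets the image commute with the intersection. \<open>F0\<close> is
      split off because the finite intersection property is applied inside one compact set.\<close>
    have img: "\<Phi> ` \<Inter>D = \<Phi> ` F0 \<inter> \<Inter> ((`) \<Phi> ` D)"
    proof -
      have "\<Phi> ` \<Inter>D = (\<Inter>F\<in>D. \<Phi> ` F)"
        using image_INT[of \<Phi> UNIV D "\<lambda>x. x" F0] F0 assms(4) by simp
      with F0 show ?thesis by blast
    qed
    have cl: "closed T" if "T \<in> (`) \<Phi> ` D" for T
      using that comp compact_imp_closed_fun by blast
    have "compact (\<Phi> ` F0 \<inter> \<Inter> ((`) \<Phi> ` D))"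
      by (intro compact_Int_closed comp F0 closed_Inter) (use cl in blast)
    moreover have "\<Phi> ` F0 \<inter> \<Inter> ((`) \<Phi> ` D) \<noteq> {}"
    proof (rule compact_imp_fip)
      show "compact (\<Phi> ` F0)" by (rule comp[OF F0])
      show "closed T" if "T \<in> (`) \<Phi> ` D" for T by (rule cl[OF that])
      show "\<Phi> ` F0 \<inter> \<Inter>F' \<noteq> {}" if F': "finite F'" "F' \<subseteq> (`) \<Phi> ` D" for F'
      proof -
        obtain E where E: "finite E" "E \<subseteq> D" "F' = (`) \<Phi> ` E"
          using F' by (meson finite_subset_image)
        \<comment> \<open>Finitely many members of a chain lie above one of them, which is
          nonempty.\<close>
        have "\<exists>G\<in>D. G \<subseteq> F0 \<and> (\<forall>F\<in>E. G \<subseteq> F)"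
          using E(1,2)
        proof (induction E rule: finite_induct)
          case empty
          then show ?case using F0 by blast
        next
          case (insert F E)
          then obtain G where G: "G \<in> D" "G \<subseteq> F0" "\<forall>F\<in>E. G \<subseteq> F" by blast
          from insert.prems have F: "F \<in> D" by blast
          show ?case
          proof (cases "F \<subseteq> G")
            case True
            then show ?thesis using F G by (intro bexI[of _ F]) auto
          next
            case False
            then have "G \<subseteq> F" using chain[OF F G(1)] by blast
            then show ?thesis using F G by (intro bexI[of _ G]) auto
          qed
        qed
        then obtain G where "G \<in> D" "G \<subseteq> F0" "\<forall>F\<in>E. G \<subseteq> F" by blast
        moreover obtain g where "g \<in> G" using ne[OF \<open>G \<in> D\<close>] by blast
        ultimately have "\<Phi> g \<in> \<Phi> ` F0 \<inter> \<Inter>F'" unfolding E(3) by blast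
        then show ?thesis by blast
      qed
    qed
    moreover have "\<Inter>D face_of K" by (rule face_of_Inter[OF D(2) face])
    ultimately show ?thesis unfolding A_def using img by auto
  qed
  \<comment> \<open>Zorn's lemma is available for maximal sets, so it is applied to complements: a
    maximal complement belongs to a minimal face.\<close>
  have "\<exists>M\<in>uminus ` A. \<forall>X\<in>uminus ` A. M \<subseteq> X \<longrightarrow> X = M"
  proof (rule subset_Zorn_nonempty)
    show "uminus ` A \<noteq> {}" using \<open>K \<in> A\<close> by blast
    fix C assume C: "C \<noteq> {}" "subset.chain (uminus ` A) C"
    have "\<Inter> (uminus ` C) \<in> A"
    proof (rule Inter)
      show "uminus ` C \<subseteq> A" using C(2) by (auto simp: subset_chain_def)
      show "S \<subseteq> T \<or> T \<subseteq> S" if "S \<in> uminus ` C" "T \<in> uminus ` C" for S T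
        using that C(2) by (auto simp: subset_chain_def) blast
    qed (use C in simp)
    moreover have "\<Union>C = - \<Inter> (uminus ` C)" by auto
    ultimately show "\<Union>C \<in> uminus ` A" by blast
  qed
  then obtain m where m: "m \<in> A" and min: "\<And>X. X \<in> A \<Longrightarrow> X \<subseteq> m \<Longrightarrow> X = m"
    by (auto simp: image_iff)
  have mface: "m face_of K" and "m \<noteq> {}" and mcomp: "compact (\<Phi> ` m)"
    using m by (auto simp: A_def)
  then obtain x where x: "x \<in> m" by blast
  have "\<Phi> z v = \<Phi> x v" if z: "z \<in> m" for z v
  proof -
    have "continuous_on (\<Phi> ` m) (\<lambda>f. f v)"
      by (rule continuous_on_subset[OF continuous_on_product_coordinates]) simp
    from continuous_attains_sup[OF mcomp _ this] x
    obtain f where f: "f \<in> \<Phi> ` m" "\<And>g. g \<in> \<Phi> ` m \<Longrightarrow> g v \<le> f v"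
      by blast
    then obtain p where p: "p \<in> m" "f = \<Phi> p" by blast
    define F where "F = {u\<in>m. \<Phi> u v = \<Phi> p v}"
    have le: "\<Phi> u v \<le> \<Phi> p v" if "u \<in> m" for u using f(2) p(2) that by blast
    have comb: "\<Phi> ((1 - s) *\<^sub>R a + s *\<^sub>R b) v = (1 - s) * \<Phi> a v + s * \<Phi> b v" for s a b
      using linear_add[OF lin[of v]] linear_cmul[OF lin[of v]] by simp
    have "F face_of m"
      unfolding face_of_def
    proof (intro conjI ballI impI)
      show "F \<subseteq> m" by (auto simp: F_def)
      show "convex F"
      proof (rule convexI)
        fix a b and s t :: real
        assume ab: "a \<in> F" "b \<in> F" and st: "0 \<le> s" "0 \<le> t" "s + t = 1"
        have "s *\<^sub>R a + t *\<^sub>R b \<in> m"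
          using convexD[OF face_of_imp_convex[OF mface]] ab st by (simp add: F_def)
        moreover have "\<Phi> (s *\<^sub>R a + t *\<^sub>R b) v = \<Phi> p v"
        proof -
          have "s = 1 - t" using st by simp
          then have "\<Phi> (s *\<^sub>R a + t *\<^sub>R b) v = (1 - t) * \<Phi> a v + t * \<Phi> b v"
            using comb[of t a b] by simp
          also have "\<dots> = \<Phi> p v" using ab by (simp add: F_def algebra_simps)
          finally show ?thesis .
        qed
        ultimately show "s *\<^sub>R a + t *\<^sub>R b \<in> F" by (simp add: F_def)
      qed
      fix a b q assume ab: "a \<in> m" "b \<in> m" and q: "q \<in> F" "q \<in> open_segment a b"
      from q(2) obtain s where s: "0 < s" "s < 1" "q = (1 - s) *\<^sub>R a + s *\<^sub>R b"
        by (auto simp: in_segment)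
      \<comment> \<open>Two nonnegative terms with sum zero both vanish, and
        \<open>0 < s < 1\<close> then puts both endpoints among the maximisers.\<close>
      have eq: "(1 - s) * (\<Phi> p v - \<Phi> a v) + s * (\<Phi> p v - \<Phi> b v) = 0"
        using comb[of s a b] q(1) s(3) by (simp add: F_def algebra_simps)
      have nn: "0 \<le> (1 - s) * (\<Phi> p v - \<Phi> a v)" "0 \<le> s * (\<Phi> p v - \<Phi> b v)"
        using le[OF ab(1)] le[OF ab(2)] s by auto
      have "(1 - s) * (\<Phi> p v - \<Phi> a v) = 0" "s * (\<Phi> p v - \<Phi> b v) = 0"
        using eq nn by linarith+
      then show "a \<in> F" "b \<in> F" using s ab by (auto simp: F_def)
    qed
    then have "F face_of K" using mface face_of_trans by blast
    moreover have "F \<noteq> {}" using p by (auto simp: F_def)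
    moreover have "compact (\<Phi> ` F)"
    proof -
      have "\<Phi> ` F = \<Phi> ` m \<inter> {f. f v = \<Phi> p v}" by (auto simp: F_def)
      moreover have "closed {f. f v = \<Phi> p v}"
        by (intro closed_Collect_eq continuous_intros continuous_on_product_coordinates)
      ultimately show ?thesis using mcomp by (simp add: compact_Int_closed)
    qed
    ultimately have "F \<in> A" by (simp add: A_def)
    then have "F = m" by (rule min) (auto simp: F_def)
    with x z have "x \<in> F" "z \<in> F" by auto
    then show ?thesis by (simp add: F_def)
  qed
  then have "\<Phi> z = \<Phi> x" if "z \<in> m" for z using that by blast
  then have "m = {x}" using x assms(4) by (auto dest: injD)
  then show ?thesis using mface by (auto simp: face_of_singleton)
qed

text \<open>\<open>M\<close> depends on \<open>u\<close> only through the finitely many values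
  \<open>J u (v j)\<close>, so it factors through a map \<open>P\<close> that is continuous for
  pointwise convergence. This gives a compact image although the ball need not be compact in norm,
  and puts Krein-Milman into finite dimension.\<close>

lemma
  fixes J :: "'u::real_normed_vector \<Rightarrow> 'p::real_normed_vector \<Rightarrow>\<^sub>L real"
    and M :: "'u \<Rightarrow> real^'d"
  assumes J: "predual_identification J" and M: "\<And>u j. M u $ j = blinfun_apply (J u) (v j)"
  shows compact_image_unit_ball: "compact (M ` {u. norm u \<le> 1})"
    and image_unit_ball_subset_hull:
      "M ` {u. norm u \<le> 1} \<subseteq> convex hull (M ` {u. u extreme_point_of {u. norm u \<le> 1}})"
proof -
  let ?B = "{u::'u. norm u \<le> 1}"
  define \<Phi> where "\<Phi> u = blinfun_apply (J u)" for u
  define P where "P f = (\<chi> j. f (v j))" for f :: "'p \<Rightarrow> real"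
  have lin: "linear J" and isom: "\<And>u. norm (J u) = norm u"
    using J by (auto simp: predual_identification_def)
  have M_eq: "M u = P (\<Phi> u)" for u by (simp add: M P_def \<Phi>_def vec_eq_iff)
  have contP: "continuous_on S P" for S
    unfolding P_def
    by (intro continuous_on_vec_lambda continuous_on_subset[OF continuous_on_product_coordinates]) simp
  have compB: "compact (\<Phi> ` ?B)"
    using compact_weak_star_unit_ball[OF J] by (simp add: \<Phi>_def[abs_def])
  have "M ` ?B = P ` \<Phi> ` ?B" by (simp add: M_eq image_image)
  with compact_continuous_image[OF contP compB] show compM: "compact (M ` ?B)" by simp
  have lin\<Phi>: "linear (\<lambda>u. \<Phi> u x)" for x
    by (rule linearI)
       (simp_all add: \<Phi>_def linear_add[OF lin] linear_cmul[OF lin] blinfun.add_left blinfun.scaleR_left)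
  have inj\<Phi>: "inj \<Phi>"
  proof (rule injI)
    fix a b assume "\<Phi> a = \<Phi> b"
    then have "J (a - b) = 0" by (simp add: \<Phi>_def linear_diff[OF lin] blinfun_apply_inject)
    then show "a = b" using isom[of "a - b"] by simp
  qed
  have linM: "linear M"
    by (rule linearI) (simp_all add: vec_eq_iff M linear_add[OF lin] linear_cmul[OF lin] blinfun.add_left blinfun.scaleR_left)
  have convB: "convex ?B"
    using convex_cball[of "0::'u" 1] by (simp add: cball_def)
  \<comment> \<open>The fibre of \<open>M\<close> over an extreme point of the image is a face of
    the ball with weak-* compact image under \<open>\<Phi>\<close>, so it has an extreme point, and
    extreme points of a face are extreme in the whole set.\<close>
  have lift: "\<exists>u. u extreme_point_of ?B \<and> M u = y" if y: "y extreme_point_of (M ` ?B)" for y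
  proof -
    define Z where "Z = {u\<in>?B. M u = y}"
    have "Z face_of ?B"
      unfolding face_of_def
    proof (intro conjI ballI impI)
      show "Z \<subseteq> ?B" by (auto simp: Z_def)
      show "convex Z"
      proof (rule convexI)
        fix a b and s t :: real
        assume ab: "a \<in> Z" "b \<in> Z" and st: "0 \<le> s" "0 \<le> t" "s + t = 1"
        have "s *\<^sub>R a + t *\<^sub>R b \<in> ?B"
          by (rule convexD[OF convB]) (use ab st in \<open>auto simp: Z_def\<close>)
        moreover have "M (s *\<^sub>R a + t *\<^sub>R b) = y"
          using ab st by (simp add: Z_def linear_add[OF linM] linear_cmul[OF linM] flip: scaleR_add_left)
        ultimately show "s *\<^sub>R a + t *\<^sub>R b \<in> Z" by (simp add: Z_def)
      qed
      fix a b q assume ab: "a \<in> ?B" "b \<in> ?B" and q: "q \<in> Z" "q \<in> open_segment a b"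
      from q(2) obtain s where s: "0 < s" "s < 1" "q = (1 - s) *\<^sub>R a + s *\<^sub>R b"
        by (auto simp: in_segment)
      have Mq: "y = (1 - s) *\<^sub>R M a + s *\<^sub>R M b"
        using q(1) by (simp add: Z_def s(3) linear_add[OF linM] linear_cmul[OF linM])
      have "M a = M b"
      proof (rule ccontr)
        assume "M a \<noteq> M b"
        then have "y \<in> open_segment (M a) (M b)" using s Mq by (auto simp: in_segment)
        then show False using y ab unfolding extreme_point_of_def by blast
      qed
      then have "M a = y" "M b = y" using Mq by (simp_all flip: scaleR_add_left)
      then show "a \<in> Z" "b \<in> Z" using ab by (auto simp: Z_def)
    qed
    moreover have "\<exists>u. u extreme_point_of Z"
    proof (rule exists_extreme_point_of[of Z \<Phi>])
      show "convex Z" using \<open>Z face_of ?B\<close> by (rule face_of_imp_convex)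
      show "Z \<noteq> {}" using y by (auto simp: Z_def extreme_point_of_def)
      have "\<Phi> ` Z = \<Phi> ` ?B \<inter> P -` {y}" by (auto simp: Z_def M_eq)
      moreover have "closed (P -` {y})" by (rule closed_vimage) (auto simp: contP)
      ultimately show "compact (\<Phi> ` Z)" using compB by (simp add: compact_Int_closed)
    qed (use inj\<Phi> lin\<Phi> in auto)
    ultimately obtain u where u: "u extreme_point_of Z" "{u} face_of ?B"
      using face_of_trans face_of_singleton by metis
    moreover have "M u = y" using u(1) by (auto simp: Z_def extreme_point_of_def)
    ultimately show ?thesis using face_of_singleton by blast
  qed
  have "M ` ?B = convex hull {y. y extreme_point_of (M ` ?B)}"
    by (rule Krein_Milman_Minkowski[OF compM convex_linear_image[OF linM convB]])
  also have "\<dots> \<subseteq> convex hull (M ` {u. u extreme_point_of ?B})"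
    by (rule hull_mono) (use lift in blast)
  finally show "M ` ?B \<subseteq> convex hull (M ` {u. u extreme_point_of ?B})" .
qed

section \<open>Existence of atomic solutions\<close>

text \<open>Entry \<open>(n, j)\<close> is component \<open>j\<close> of \<open>M\<close> applied to
  the value at \<open>x n\<close> of the function generated by the Dirac measure at
  \<open>fst t\<close> with vector \<open>snd t\<close>.\<close>

definition atom ::
    "('x \<times> 'w \<Rightarrow> real) \<Rightarrow> (nat \<Rightarrow> 'x) \<Rightarrow> ('u \<Rightarrow> real^'d) \<Rightarrow> 'w \<times> 'u \<Rightarrow> nat \<times> 'd \<Rightarrow> real" where
  "atom \<phi> x M t i = \<phi> (x (fst i), fst t) * M (snd t) $ snd i"

lemma conic_rep_atom_convex_hull:
  fixes \<phi> :: "'x \<times> 'w \<Rightarrow> real" and M :: "'u \<Rightarrow> real^'d"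
  assumes "M ` U \<subseteq> convex hull (M ` E)"
    and "conic_rep I (atom \<phi> x M) (UNIV \<times> U) f K"
  shows "conic_rep I (atom \<phi> x M) (UNIV \<times> E) f K"
proof (rule conic_rep_trans[OF _ assms(2)])
  fix t :: "'w \<times> 'u" assume "t \<in> UNIV \<times> U"
  then have "M (snd t) \<in> convex hull (M ` E)" using assms(1) by auto
  then obtain S c where S: "finite S" "S \<subseteq> M ` E" "\<forall>z\<in>S. 0 \<le> c z" "sum c S = 1"
    "(\<Sum>z\<in>S. c z *\<^sub>R z) = M (snd t)" unfolding convex_hull_explicit by blast
  have "\<forall>z\<in>S. \<exists>u. u \<in> E \<and> M u = z" using S(2) by blast
  from bchoice[OF this] obtain e where e: "\<And>z. z \<in> S \<Longrightarrow> e z \<in> E" "\<And>z. z \<in> S \<Longrightarrow> M (e z) = z"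
    by blast
  have "conic_rep I (atom \<phi> x M) (UNIV \<times> E) (\<lambda>i. \<Sum>z\<in>S. c z * atom \<phi> x M (fst t, e z) i) (\<Sum>z\<in>S. c z * 1)"
    using S(1,3) e(1) by (intro conic_rep_sum conic_rep_scale conic_rep_atom) auto
  then show "conic_rep I (atom \<phi> x M) (UNIV \<times> E) (atom \<phi> x M t) 1"
  proof (rule conic_rep_mono)
    show "(\<Sum>z\<in>S. c z * 1) \<le> 1" using S(4) by simp
    fix i :: "nat \<times> 'd"
    have "M (snd t) $ snd i = (\<Sum>z\<in>S. c z * z $ snd i)" by (simp flip: S(5))
    then show "(\<Sum>z\<in>S. c z * atom \<phi> x M (fst t, e z) i) = atom \<phi> x M t i"
      using e(2) by (simp add: atom_def sum_distrib_left mult.left_commute)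
  qed
qed

text \<open>
  A nonzero limit keeps the weights in a compact set; the point at infinity only yields the zero
  vector, which is an atom anyway (for \<open>u = 0\<close>).
\<close>

lemma C0_limit_attained:
  fixes \<phi> :: "'x::t2_space \<times> 'w::t2_space \<Rightarrow> real"
  assumes "\<phi> \<in> C0" "finite J" and lim: "\<And>n. n \<in> J \<Longrightarrow> (\<lambda>k::nat. \<phi> (x n, w k)) \<longlonglongrightarrow> \<sigma> n"
    and n0: "n0 \<in> J" "\<sigma> n0 \<noteq> 0"
  shows "\<exists>w0. \<forall>n\<in>J. \<phi> (x n, w0) = \<sigma> n"
proof -
  \<comment> \<open>Half the limit is a threshold that the sequence eventually exceeds, so
    \<open>Q\<close> is a compact set containing a tail of the weights.\<close>
  define Q where "Q = {w. \<bar>\<sigma> n0\<bar> / 2 \<le> \<bar>\<phi> (x n0, w)\<bar>}"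
  \<comment> \<open>\<open>Q\<close> need not be sequentially compact, so no subsequence of weights
    is extracted. Instead \<open>h\<close>, the distance to the limiting values, attains its minimum
    on \<open>Q\<close>; as it tends to 0 along the sequence, this minimum is 0.\<close>
  define h where "h w = (\<Sum>n\<in>J. \<bar>\<phi> (x n, w) - \<sigma> n\<bar>)" for w
  have "compact Q" unfolding Q_def by (rule C0_slice_compact[OF assms(1)]) (use n0 in simp)
  have conth: "continuous_on Q h"
    unfolding h_def
    by (intro continuous_on_sum continuous_on_rabs continuous_on_diff continuous_on_const
        continuous_on_subset[OF C0_slice_continuous[OF assms(1)] subset_UNIV])
  have "(\<lambda>k. \<bar>\<phi> (x n0, w k)\<bar>) \<longlonglongrightarrow> \<bar>\<sigma> n0\<bar>" by (intro tendsto_rabs lim n0)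
  then have "\<forall>\<^sub>F k in sequentially. \<bar>\<sigma> n0\<bar> / 2 < \<bar>\<phi> (x n0, w k)\<bar>"
    by (rule order_tendstoD) (use n0 in simp)
  then obtain k0 where "\<And>k. k0 \<le> k \<Longrightarrow> \<bar>\<sigma> n0\<bar> / 2 < \<bar>\<phi> (x n0, w k)\<bar>"
    unfolding eventually_sequentially by blast
  then have k0: "w k \<in> Q" if "k0 \<le> k" for k
    unfolding Q_def using that by (simp add: less_imp_le)
  then have "Q \<noteq> {}" by blast
  from continuous_attains_inf[OF \<open>compact Q\<close> this conth]
  obtain w0 where w0: "\<And>w. w \<in> Q \<Longrightarrow> h w0 \<le> h w" by blast
  have "(\<lambda>k. h (w k)) \<longlonglongrightarrow> (\<Sum>n\<in>J. \<bar>\<sigma> n - \<sigma> n\<bar>)"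
    unfolding h_def by (intro tendsto_sum tendsto_rabs tendsto_diff tendsto_const lim)
  then have "h w0 \<le> (\<Sum>n\<in>J. \<bar>\<sigma> n - \<sigma> n\<bar>)"
    by (rule LIMSEQ_le_const) (use k0 w0 in blast)
  moreover have "0 \<le> h w0" by (simp add: h_def sum_nonneg)
  ultimately have "h w0 = 0" by simp
  then have "\<forall>n\<in>J. \<bar>\<phi> (x n, w0) - \<sigma> n\<bar> = 0"
    unfolding h_def by (subst (asm) sum_nonneg_eq_0_iff[OF assms(2)]) simp_all
  then show ?thesis by (intro exI[of _ w0]) simp
qed

text \<open>The two factors of an atom are made to converge separately: the vectors
  \<open>M u\<close> in a compact set, the finitely many values of \<open>\<phi>\<close> in bounded
  intervals. Limits of both factors are then attained independently of each other.\<close>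

lemma atom_closed:
  fixes \<phi> :: "'x::t2_space \<times> 'w::t2_space \<Rightarrow> real" and M :: "'u::real_vector \<Rightarrow> real^'d"
  assumes "\<phi> \<in> C0" "linear M" "compact (M ` U)" "0 \<in> U"
    and t: "\<And>k::nat. t k \<in> UNIV \<times> U"
    and lim: "\<And>i. i \<in> {1..N} \<times> UNIV \<Longrightarrow> (\<lambda>k. atom \<phi> x M (t k) i) \<longlonglongrightarrow> l i"
  shows "\<exists>s\<in>UNIV \<times> U. \<forall>i\<in>{1..N} \<times> UNIV. atom \<phi> x M s i = l i"
proof -
  have "\<forall>k. M (snd (t k)) \<in> M ` U" using t by (auto simp: mem_Times_iff)
  with assms(3) obtain \<nu> r1 where \<nu>: "\<nu> \<in> M ` U" and r1: "strict_mono r1"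
    "((\<lambda>k. M (snd (t k))) \<circ> r1) \<longlonglongrightarrow> \<nu>"
    unfolding compact_def by meson
  obtain u0 where u0: "u0 \<in> U" "\<nu> = M u0" using \<nu> by blast
  have bdd: "bounded (range (\<lambda>k. \<phi> (x n, fst (t (r1 k)))))" for n
  proof -
    obtain B where "\<And>w. \<bar>\<phi> (x n, w)\<bar> \<le> B" using C0_slice_bounded[OF assms(1)] by blast
    then show ?thesis by (auto simp: bounded_iff)
  qed
  obtain r2 \<sigma> where r2: "strict_mono r2"
    "\<forall>n\<in>{1..N}. (\<lambda>k. \<phi> (x n, fst (t (r1 (r2 k))))) \<longlonglongrightarrow> \<sigma> n"
    using bounded_convergent_subseq[of "{1..N}" "\<lambda>k n. \<phi> (x n, fst (t (r1 k)))", OF finite_atLeastAtMost bdd]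
    by blast
  have Mlim: "(\<lambda>k. M (snd (t (r1 (r2 k))))) \<longlonglongrightarrow> \<nu>"
    using LIMSEQ_subseq_LIMSEQ[OF r1(2) r2(1)] by (simp add: o_def)
  have l: "l (n, j) = \<sigma> n * \<nu> $ j" if n: "n \<in> {1..N}" for n j
  proof (rule LIMSEQ_unique)
    have "(n, j) \<in> {1..N} \<times> UNIV" using n by simp
    from LIMSEQ_subseq_LIMSEQ[OF lim[OF this] strict_mono_o[OF r1(1) r2(1)]]
    show "(\<lambda>k. atom \<phi> x M (t (r1 (r2 k))) (n, j)) \<longlonglongrightarrow> l (n, j)" by (simp add: o_def)
    show "(\<lambda>k. atom \<phi> x M (t (r1 (r2 k))) (n, j)) \<longlonglongrightarrow> \<sigma> n * \<nu> $ j"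
      unfolding atom_def fst_conv snd_conv
      by (intro tendsto_mult tendsto_vec_nth Mlim r2(2)[rule_format] n)
  qed
  show ?thesis
  proof (cases "\<forall>n\<in>{1..N}. \<sigma> n = 0")
    case True
    have "atom \<phi> x M (undefined, 0) i = l i" if "i \<in> {1..N} \<times> UNIV" for i
      using that True l by (auto simp: atom_def linear_0[OF assms(2)])
    then show ?thesis using assms(4) by (intro bexI[of _ "(undefined, 0)"]) auto
  next
    case False
    then obtain n0 where n0: "n0 \<in> {1..N}" "\<sigma> n0 \<noteq> 0" by blast
    obtain w0 where w0: "\<forall>n\<in>{1..N}. \<phi> (x n, w0) = \<sigma> n"
      using C0_limit_attained[of \<phi> "{1..N}" x "\<lambda>k. fst (t (r1 (r2 k)))" \<sigma> n0,
          OF assms(1) finite_atLeastAtMost r2(2)[rule_format] n0] by blast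
    have "atom \<phi> x M (w0, u0) i = l i" if "i \<in> {1..N} \<times> UNIV" for i
      using that w0 l by (auto simp: atom_def u0(2))
    then show ?thesis using u0(1) by (intro bexI[of _ "(w0, u0)"]) auto
  qed
qed

lemma atom_bounded:
  fixes \<phi> :: "'x::t2_space \<times> 'w::t2_space \<Rightarrow> real" and M :: "'u \<Rightarrow> real^'d"
  assumes "\<phi> \<in> C0" "bounded (M ` U)"
  shows "bounded ((\<lambda>t. atom \<phi> x M t i) ` (UNIV \<times> U))"
proof -
  obtain B where B: "\<And>w. \<bar>\<phi> (x (fst i), w)\<bar> \<le> B" using C0_slice_bounded[OF assms(1)] by blast
  obtain C where C: "\<And>u. u \<in> U \<Longrightarrow> norm (M u) \<le> C" using assms(2) by (auto simp: bounded_iff)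
  have "\<bar>atom \<phi> x M t i\<bar> \<le> B * C" if "t \<in> UNIV \<times> U" for t
  proof -
    have "\<bar>M (snd t) $ snd i\<bar> \<le> C"
      using that C[of "snd t"] component_le_norm_cart[of "M (snd t)" "snd i"]
      by (auto simp: mem_Times_iff)
    moreover have "0 \<le> B" using B[of undefined] by linarith
    ultimately show ?thesis
      unfolding atom_def abs_mult using B by (intro mult_mono) auto
  qed
  then show ?thesis by (auto simp: bounded_iff)
qed

text \<open>A polar decomposition piece by piece: \<open>\<mu> A\<close> is the weight
  \<open>norm (\<mu> A)\<close> times the direction \<open>sgn (\<mu> A)\<close> in the unit ball,
  and these weights sum to at most the variation.\<close>

lemma rkbs_op_atomic_approximation:
  fixes \<phi> :: "'x::t2_space \<times> 'w::t2_space \<Rightarrow> real" and \<mu> :: "'w set \<Rightarrow> 'u::banach"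
    and M :: "'u \<Rightarrow> real^'d"
  assumes "\<phi> \<in> C0" "bounded_linear M" "\<mu> \<in> vv_measures" "0 < e"
  shows "\<exists>f. conic_rep ({1..N} \<times> UNIV) (atom \<phi> x M) (UNIV \<times> {u. norm u \<le> 1}) f (mass \<mu>) \<and>
      (\<forall>n\<in>{1..N}. \<forall>j. \<bar>f (n, j) - M (rkbs_op \<phi> \<mu> (x n)) $ j\<bar> < e)"
proof -
  interpret M: bounded_linear M by fact
  obtain K where K: "0 < K" "\<And>z. norm (M z) \<le> norm z * K" using M.pos_bounded by blast
  \<comment> \<open>\<open>M\<close> enlarges errors by at most the factor \<open>K\<close>.\<close>
  have "0 < e / K" using K(1) assms(4) by simp
  from vv_integrals_approximation[of \<mu> "{1..N}" "\<lambda>n w. \<phi> (x n, w)" "\<lambda>n. rkbs_op \<phi> \<mu> (x n)",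
      OF assms(3) finite_atLeastAtMost has_vv_integral_rkbs_op[OF assms(1,3)] this]
  obtain P p where P: "finite P" "(\<Sum>A\<in>P. norm (\<mu> A)) \<le> mass \<mu>"
    and approx: "\<And>n. n \<in> {1..N} \<Longrightarrow>
      norm ((\<Sum>A\<in>P. \<phi> (x n, p A) *\<^sub>R \<mu> A) - rkbs_op \<phi> \<mu> (x n)) < e / K" by blast
  define f where "f i = (\<Sum>A\<in>P. norm (\<mu> A) * atom \<phi> x M (p A, sgn (\<mu> A)) i)" for i
  have "conic_rep ({1..N} \<times> UNIV) (atom \<phi> x M) (UNIV \<times> {u. norm u \<le> 1}) f (\<Sum>A\<in>P. norm (\<mu> A) * 1)"
    unfolding f_def using P(1)
    by (intro conic_rep_sum conic_rep_scale conic_rep_atom) (auto simp: norm_sgn)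
  then have "conic_rep ({1..N} \<times> UNIV) (atom \<phi> x M) (UNIV \<times> {u. norm u \<le> 1}) f (mass \<mu>)"
    by (rule conic_rep_mono) (use P(2) in auto)
  moreover have "\<bar>f (n, j) - M (rkbs_op \<phi> \<mu> (x n)) $ j\<bar> < e" if n: "n \<in> {1..N}" for n j
  proof -
    have sgn: "norm z * M (sgn z) $ j = M z $ j" for z
    proof -
      have "norm z *\<^sub>R sgn z = z" by (cases "z = 0") (simp_all add: sgn_div_norm)
      then have "M z = norm z *\<^sub>R M (sgn z)" by (metis M.scaleR)
      then show ?thesis by simp
    qed
    have "f (n, j) = (\<Sum>A\<in>P. \<phi> (x n, p A) * (norm (\<mu> A) * M (sgn (\<mu> A)) $ j))"
      unfolding f_def atom_def fst_conv snd_conv by (simp only: mult.left_commute)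
    also have "\<dots> = M (\<Sum>A\<in>P. \<phi> (x n, p A) *\<^sub>R \<mu> A) $ j"
      by (simp add: sgn M.sum M.scaleR)
    finally have "f (n, j) - M (rkbs_op \<phi> \<mu> (x n)) $ j
        = M ((\<Sum>A\<in>P. \<phi> (x n, p A) *\<^sub>R \<mu> A) - rkbs_op \<phi> \<mu> (x n)) $ j"
      by (simp add: M.diff)
    also have "\<bar>\<dots>\<bar> \<le> norm (M ((\<Sum>A\<in>P. \<phi> (x n, p A) *\<^sub>R \<mu> A) - rkbs_op \<phi> \<mu> (x n)))"
      by (rule component_le_norm_cart)
    also have "\<dots> \<le> norm ((\<Sum>A\<in>P. \<phi> (x n, p A) *\<^sub>R \<mu> A) - rkbs_op \<phi> \<mu> (x n)) * K" by (rule K(2))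
    also have "\<dots> < e / K * K" by (rule mult_strict_right_mono[OF approx[OF n] K(1)])
    finally show ?thesis using K(1) by simp
  qed
  ultimately show ?thesis by blast
qed

section \<open>Coercive functions and the existence theorem\<close>

lemma coercive_sublevel_bounded:
  fixes f :: "'a::real_normed_vector \<Rightarrow> real"
  assumes "coercive f"
  shows "\<exists>b. \<forall>t. f t \<le> Z \<longrightarrow> norm t \<le> b"
proof -
  have "\<forall>\<^sub>F t in at_infinity. Z < f t"
    using assms by (auto simp: coercive_def filterlim_at_top_dense)
  then obtain b where "\<And>t. b \<le> norm t \<Longrightarrow> Z < f t" by (auto simp: eventually_at_infinity)
  then have "f t \<le> Z \<longrightarrow> norm t \<le> b" for t by (meson linear not_less)
  then show ?thesis by blast
qed

text \<open>Outside some ball \<open>f\<close> exceeds \<open>f 0\<close>, and on the ball it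
  attains a minimum.\<close>

lemma coercive_bounded_below:
  fixes f :: "'a::euclidean_space \<Rightarrow> real"
  assumes "coercive f" "continuous_on UNIV f"
  shows "\<exists>m. \<forall>t. m \<le> f t"
proof -
  obtain b where b: "\<And>t. f t \<le> f 0 \<Longrightarrow> norm t \<le> b"
    using coercive_sublevel_bounded[OF assms(1)] by blast
  then have "cball 0 b \<noteq> {}" using b[of 0] by simp
  with continuous_attains_inf[OF compact_cball this continuous_on_subset[OF assms(2) subset_UNIV]]
  obtain s where "\<forall>t\<in>cball 0 b. f s \<le> f t" by blast
  then have s: "f s \<le> f t" if "norm t \<le> b" for t using that by simp
  have "min (f s) (f 0) \<le> f t" for t
    using b[of t] s[of t] by (cases "f t \<le> f 0") auto
  then show ?thesis by blast
qed

theorem theorem4p4: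
  fixes x :: "nat \<Rightarrow> 'x::t2_space"
    and y :: "nat \<Rightarrow> real^'d"
    and N :: nat
    and L :: "real^'d \<Rightarrow> real^'d \<Rightarrow> real"
    and \<phi> :: "'x \<times> 'w::t2_space \<Rightarrow> real"
    and J :: "'u::banach \<Rightarrow> 'p::banach \<Rightarrow>\<^sub>L real"
    and M :: "'u \<Rightarrow> real^'d"
    and v :: "'d \<Rightarrow> 'p"
    and lam :: real
  assumes "locally_compact_space (euclidean :: 'x topology)"
    and "locally_compact_space (euclidean :: 'w topology)"
    and "\<phi> \<in> C0"
    and "N \<ge> 1"
    and "\<And>z. convex_on UNIV (\<lambda>t. L t z)"
    and "\<And>z. coercive (\<lambda>t. L t z)"
    and "\<And>z. lower_semicontinuous (\<lambda>t. L t z)"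
    and "predual_identification J"
    and "bounded_linear M"
    and "\<And>u j. M u $ j = blinfun_apply (J u) (v j)"
    and "lam \<ge> 0"
  shows "\<exists>(a :: nat \<Rightarrow> real) (w :: nat \<Rightarrow> 'w) (u :: nat \<Rightarrow> 'u) \<mu>d fd.
           (\<forall>m \<in> {1..N * CARD('d)}. u m extreme_point_of {u. norm u \<le> 1}) \<and>
           \<mu>d = (\<lambda>E. \<Sum>m=1..N * CARD('d). a m *\<^sub>R vv_dirac (w m) (u m) E) \<and>
           \<mu>d \<in> vv_measures \<and>
           fd = rkbs_op \<phi> \<mu>d \<and>
           fd = (\<lambda>\<xi>. \<Sum>m=1..N * CARD('d). (a m * \<phi> (\<xi>, w m)) *\<^sub>R u m) \<and>
           is_arg_min (learning_objective L M N x y lam \<phi>) (\<lambda>f. f \<in> rkbs \<phi>) fd"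
proof -
  interpret M: bounded_linear M by fact
  note \<phi> = assms(3) and lam = assms(11)
  let ?B = "{u::'u. norm u \<le> 1}"
  let ?Ext = "{u. u extreme_point_of ?B}"
  define I where "I = {1..N} \<times> (UNIV :: 'd set)"
  define A where "A = (UNIV :: 'w set) \<times> ?B"
  define \<psi> where "\<psi> = atom \<phi> x M"
  have finI: "finite I" and cardI: "card I = N * CARD('d)"
    by (simp_all add: I_def card_cartesian_product)
  have compB: "compact (M ` ?B)" by (rule compact_image_unit_ball[OF assms(8,10)])
  have hull: "M ` ?B \<subseteq> convex hull (M ` ?Ext)" by (rule image_unit_ball_subset_hull[OF assms(8,10)])
  \<comment> \<open>Existence of extreme points is read off from the hull inclusion, as the image of
    the ball is nonempty.\<close>
  have "M 0 \<in> M ` ?B" by (rule imageI) simp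
  with hull have "convex hull (M ` ?Ext) \<noteq> {}" by blast
  then have Ext_ne: "?Ext \<noteq> {}" by simp
  have sym: "\<exists>t'\<in>A. \<forall>i\<in>I. \<psi> t' i = - \<psi> t i" if "t \<in> A" for t
    using that by (intro bexI[of _ "(fst t, - snd t)"]) (auto simp: A_def \<psi>_def atom_def M.neg)
  have \<psi>_bounded: "bounded ((\<lambda>t. \<psi> t i) ` A)" for i
    unfolding \<psi>_def A_def by (rule atom_bounded[OF \<phi> compact_imp_bounded[OF compB]])
  have \<psi>_closed: "\<exists>s\<in>A. \<forall>i\<in>I. \<psi> s i = l i"
    if "\<And>k::nat. t k \<in> A" "\<And>i. i \<in> I \<Longrightarrow> (\<lambda>k. \<psi> (t k) i) \<longlonglongrightarrow> l i" for t l
    using that unfolding A_def \<psi>_def I_def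
    by (intro atom_closed[OF \<phi> bounded_linear.linear[OF assms(9)] compB, where t = t]; simp)
  define F where "F c = (1 / real N) * (\<Sum>n=1..N. L (\<chi> j. c (n, j)) (y n))" for c
  define smp where "smp f i = M (f (x (fst i))) $ snd i" for f i
  define obj where "obj = learning_objective L M N x y lam \<phi>"
  have obj: "obj f = F (smp f) + lam * rkbs_norm \<phi> f" for f
    by (simp add: obj_def learning_objective_def F_def smp_def)
  \<comment> \<open>A finite convex function on a finite-dimensional space is continuous.\<close>
  have contL: "continuous_on UNIV (\<lambda>t. L t z)" for z
    by (rule convex_on_continuous[OF open_UNIV assms(5)])
  have F_tendsto: "(\<lambda>k. F (c k)) \<longlonglongrightarrow> F g" if c: "\<And>i. i \<in> I \<Longrightarrow> (\<lambda>k::nat. c k i) \<longlonglongrightarrow> g i" for c g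
    unfolding F_def
  proof (intro tendsto_mult tendsto_const tendsto_sum)
    fix n assume n: "n \<in> {1..N}"
    have "(\<lambda>k. \<chi> j. c k (n, j)) \<longlonglongrightarrow> (\<chi> j. g (n, j))"
      by (intro tendsto_vec_lambda c) (use n in \<open>simp add: I_def\<close>)
    then show "(\<lambda>k. L (\<chi> j. c k (n, j)) (y n)) \<longlonglongrightarrow> L (\<chi> j. g (n, j)) (y n)"
      using continuous_on_tendsto_compose[OF contL] by simp
  qed
  have "\<forall>n. \<exists>b. \<forall>t. b \<le> L t (y n)"
    using coercive_bounded_below[OF assms(6) contL] by blast
  then obtain b where b: "\<And>n t. b n \<le> L t (y n)" by metis
  define F0 where "F0 = (1 / real N) * (\<Sum>n=1..N. b n)"
  have F_ge: "F0 \<le> F c" for c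
    unfolding F0_def F_def by (intro mult_left_mono sum_mono b) simp
  \<comment> \<open>All other losses lie above their lower bounds, so a bound on the mean loss
    bounds each single one; the factor \<open>N\<close> undoes the mean.\<close>
  have L_le: "L (\<chi> j. c (n, j)) (y n) \<le> b n + N * (F c - F0)" if n: "n \<in> {1..N}" for c n
  proof -
    have "L (\<chi> j. c (n, j)) (y n) - b n \<le> (\<Sum>n=1..N. L (\<chi> j. c (n, j)) (y n) - b n)"
      by (rule member_le_sum[OF n]) (use b in simp_all)
    also have "\<dots> = N * (F c - F0)"
      using assms(4) by (simp add: F_def F0_def sum_subtractf right_diff_distrib)
    finally show ?thesis by simp
  qed
  have obj_ge: "F0 \<le> obj f" if "f \<in> rkbs \<phi>" for f
    unfolding obj using F_ge[of "smp f"] mult_nonneg_nonneg[OF lam rkbs_norm_nonneg[OF that]] by simp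
  have bdd: "bdd_below (obj ` rkbs \<phi>)" using obj_ge by (rule bdd_belowI2)
  have "(\<lambda>_ :: 'w set. 0 :: 'u) \<in> vv_measures"
    using dirac_sum_in_vv_measures[OF finite.emptyI] by simp
  then have "rkbs_op \<phi> (\<lambda>_ :: 'w set. 0 :: 'u) \<in> rkbs \<phi>" unfolding rkbs_def by blast
  then have ne: "obj ` rkbs \<phi> \<noteq> {}" by blast
  define m where "m = Inf (obj ` rkbs \<phi>)"
  have m_le: "m \<le> obj f" if "f \<in> rkbs \<phi>" for f
    unfolding m_def using that by (intro cInf_lower[OF _ bdd]) simp
  define \<epsilon> where "\<epsilon> k = inverse (real (Suc k))" for k
  have \<epsilon>: "0 < \<epsilon> k" "\<epsilon> k \<le> 1" for k by (simp_all add: \<epsilon>_def field_simps)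
  have \<epsilon>_lim: "\<epsilon> \<longlonglongrightarrow> 0" unfolding \<epsilon>_def[abs_def] by (rule LIMSEQ_inverse_real_of_nat)
  \<comment> \<open>One \<open>\<epsilon> k\<close> is lost in the infimum of the objective and
    \<open>lam * \<epsilon> k\<close> in the infimum defining the norm. The exact samples of
    \<open>\<mu>\<close> enter the objective, while only the nearby \<open>c\<close> is known to be
    a conic combination.\<close>
  have "\<exists>\<mu> c. \<mu> \<in> vv_measures \<and> F (smp (rkbs_op \<phi> \<mu>)) + lam * mass \<mu> \<le> m + (1 + lam) * \<epsilon> k \<and>
      conic_rep I \<psi> A c (mass \<mu>) \<and> (\<forall>i\<in>I. \<bar>c i - smp (rkbs_op \<phi> \<mu>) i\<bar> < \<epsilon> k)" for k
  proof -
    have "Inf (obj ` rkbs \<phi>) < m + \<epsilon> k" using \<epsilon>(1)[of k] by (simp add: m_def)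
    from cInf_lessD[OF ne this] obtain f where f: "f \<in> rkbs \<phi>" "obj f < m + \<epsilon> k" by blast
    from rkbs_norm_approx[OF f(1) \<epsilon>(1)[of k]]
    obtain \<mu> where \<mu>: "\<mu> \<in> vv_measures" "f = rkbs_op \<phi> \<mu>" "mass \<mu> < rkbs_norm \<phi> f + \<epsilon> k" by blast
    from rkbs_op_atomic_approximation[OF \<phi> assms(9) \<mu>(1) \<epsilon>(1)[of k], of N x]
    obtain c where c: "conic_rep I \<psi> A c (mass \<mu>)"
      "\<forall>n\<in>{1..N}. \<forall>j. \<bar>c (n, j) - M (rkbs_op \<phi> \<mu> (x n)) $ j\<bar> < \<epsilon> k"
      unfolding I_def \<psi>_def A_def by blast
    have "lam * mass \<mu> \<le> lam * (rkbs_norm \<phi> f + \<epsilon> k)" using \<mu>(3) lam by (intro mult_left_mono) auto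
    then have "F (smp f) + lam * mass \<mu> \<le> m + (1 + lam) * \<epsilon> k"
      using f(2) unfolding obj by (simp add: algebra_simps)
    moreover have "\<forall>i\<in>I. \<bar>c i - smp (rkbs_op \<phi> \<mu>) i\<bar> < \<epsilon> k"
      using c(2) by (auto simp: I_def smp_def)
    ultimately show ?thesis using \<mu>(1,2) c(1) by blast
  qed
  then have "\<forall>k. \<exists>p. fst p \<in> vv_measures \<and> F (smp (rkbs_op \<phi> (fst p))) + lam * mass (fst p) \<le> m + (1 + lam) * \<epsilon> k \<and>
      conic_rep I \<psi> A (snd p) (mass (fst p)) \<and> (\<forall>i\<in>I. \<bar>snd p i - smp (rkbs_op \<phi> (fst p)) i\<bar> < \<epsilon> k)"
    by simp
  from choice[OF this] obtain p where p: "\<forall>k. fst (p k) \<in> vv_measures \<and>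
      F (smp (rkbs_op \<phi> (fst (p k)))) + lam * mass (fst (p k)) \<le> m + (1 + lam) * \<epsilon> k \<and>
      conic_rep I \<psi> A (snd (p k)) (mass (fst (p k))) \<and>
      (\<forall>i\<in>I. \<bar>snd (p k) i - smp (rkbs_op \<phi> (fst (p k))) i\<bar> < \<epsilon> k)" by blast
  define R where "R k = mass (fst (p k))" for k
  define s where "s k = smp (rkbs_op \<phi> (fst (p k)))" for k
  define c where "c k = snd (p k)" for k
  have R0: "0 \<le> R k" for k by (simp add: R_def)
  have val: "F (s k) + lam * R k \<le> m + (1 + lam) * \<epsilon> k"
    and rep: "conic_rep I \<psi> A (c k) (R k)"
    and close: "i \<in> I \<Longrightarrow> \<bar>c k i - s k i\<bar> < \<epsilon> k" for k i
    using p unfolding R_def s_def c_def by blast+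
  have val1: "F (s k) + lam * R k \<le> m + (1 + lam)" for k
  proof -
    have "(1 + lam) * \<epsilon> k \<le> (1 + lam) * 1" using \<epsilon>(2) lam by (intro mult_left_mono) auto
    then have "m + (1 + lam) * \<epsilon> k \<le> m + (1 + lam)" by simp
    with val[of k] show ?thesis by (rule order_trans)
  qed
  \<comment> \<open>For positive \<open>lam\<close> the objective bounds the masses and
    \<open>K = R\<close> works. For \<open>lam = 0\<close> the masses may be unbounded, but weights
    cost nothing, so the \<open>c k\<close> may be represented anew with weights bounded in terms of
    their coordinates.\<close>
  have "\<exists>K. bounded (range K) \<and> (\<forall>k. conic_rep I \<psi> A (c k) (K k) \<and> lam * K k \<le> lam * R k)"
  proof (cases "lam = 0")
    case False
    then have "0 < lam" using lam by simp
    have "\<bar>R k\<bar> \<le> (m + (1 + lam) - F0) / lam" for k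
      using val1[of k] F_ge[of "s k"] R0[of k] \<open>0 < lam\<close> by (simp add: pos_le_divide_eq mult.commute)
    then have "bounded (range R)" by (auto simp: bounded_iff)
    then show ?thesis using rep by (intro exI[of _ R]) simp
  next
    case True
    have "\<exists>B. \<forall>k. \<bar>c k i\<bar> \<le> B" if i: "i \<in> I" for i
    proof -
      obtain n j where nj: "i = (n, j)" "n \<in> {1..N}" using i by (auto simp: I_def)
      define Z where "Z = b n + N * (m + (1 + lam) - F0)"
      obtain B where B: "\<And>t. L t (y n) \<le> Z \<Longrightarrow> norm t \<le> B"
        using coercive_sublevel_bounded[OF assms(6)] by blast
      \<comment> \<open>\<open>B\<close> bounds the exact sample \<open>s k i\<close>, and
        \<open>c k i\<close> is within \<open>\<epsilon> k\<close>, at most 1, of it.\<close>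
      have "\<bar>c k i\<bar> \<le> B + 1" for k
      proof -
        have "F (s k) \<le> m + (1 + lam)" using val1[of k] True by simp
        then have "N * (F (s k) - F0) \<le> N * (m + (1 + lam) - F0)" by (intro mult_left_mono) auto
        then have "L (\<chi> j. s k (n, j)) (y n) \<le> Z" using L_le[OF nj(2), of "s k"] by (simp add: Z_def)
        then have "norm (\<chi> j. s k (n, j)) \<le> B" by (rule B)
        moreover have "\<bar>s k i\<bar> \<le> norm (\<chi> j. s k (n, j))"
          using component_le_norm_cart[of "\<chi> j. s k (n, j)" j] by (simp add: nj(1))
        ultimately show ?thesis using close[OF i, of k] \<epsilon>(2)[of k] by linarith
      qed
      then show ?thesis by blast
    qed
    then have "\<forall>i\<in>I. \<exists>B. \<forall>k. \<bar>c k i\<bar> \<le> B" by blast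
    from bchoice[OF this] obtain B where B: "\<And>i k. i \<in> I \<Longrightarrow> \<bar>c k i\<bar> \<le> B i" by blast
    obtain C where C: "0 \<le> C" "\<And>f K. conic_rep I \<psi> A f K \<Longrightarrow> conic_rep I \<psi> A f (C * (\<Sum>i\<in>I. \<bar>f i\<bar>))"
      using conic_rep_bounded[OF finI sym] by blast
    have "\<bar>C * (\<Sum>i\<in>I. \<bar>c k i\<bar>)\<bar> \<le> C * (\<Sum>i\<in>I. B i)" for k
      using C(1) B by (simp add: abs_mult sum_nonneg mult_left_mono sum_mono)
    then have "bounded (range (\<lambda>k. C * (\<Sum>i\<in>I. \<bar>c k i\<bar>)))" by (auto simp: bounded_iff)
    then show ?thesis
      using C(2)[OF rep] True by (intro exI[of _ "\<lambda>k. C * (\<Sum>i\<in>I. \<bar>c k i\<bar>)"]) simp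
  qed
  then obtain K where K: "bounded (range K)" "\<And>k. conic_rep I \<psi> A (c k) (K k)" "\<And>k. lam * K k \<le> lam * R k"
    by blast
  have "A \<noteq> {}" by (auto simp: A_def intro!: exI[of _ 0])
  have "\<exists>r g L. strict_mono r \<and> conic_rep I \<psi> A g L \<and> (\<lambda>k. K (r k)) \<longlonglongrightarrow> L \<and>
      (\<forall>i\<in>I. (\<lambda>k. c (r k) i) \<longlonglongrightarrow> g i)"
    by (rule conic_rep_limit[OF finI \<open>A \<noteq> {}\<close> \<psi>_bounded _ K(2,1)]) (rule \<psi>_closed)
  then obtain r g K0 where r: "strict_mono r" and g: "conic_rep I \<psi> A g K0"
    and limK: "(\<lambda>k. K (r k)) \<longlonglongrightarrow> K0" and limc: "\<forall>i\<in>I. (\<lambda>k. c (r k) i) \<longlonglongrightarrow> g i" by blast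
  have \<epsilon>_lim_r: "(\<lambda>k. \<epsilon> (r k)) \<longlonglongrightarrow> 0" using LIMSEQ_subseq_LIMSEQ[OF \<epsilon>_lim r] by (simp add: o_def)
  have lims: "(\<lambda>k. s (r k) i) \<longlonglongrightarrow> g i" if i: "i \<in> I" for i
  proof -
    have "(\<lambda>k. s (r k) i - c (r k) i) \<longlonglongrightarrow> 0"
      by (rule Lim_null_comparison[OF always_eventually \<epsilon>_lim_r])
         (use close[OF i] in \<open>simp add: abs_minus_commute less_imp_le\<close>)
    from tendsto_add[OF this limc[rule_format, OF i]] show ?thesis by simp
  qed
  have "F g + lam * K0 \<le> m + (1 + lam) * 0"
  proof (rule LIMSEQ_le)
    show "(\<lambda>k. F (s (r k)) + lam * K (r k)) \<longlonglongrightarrow> F g + lam * K0"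
      by (intro tendsto_add tendsto_mult tendsto_const limK F_tendsto lims)
    show "(\<lambda>k. m + (1 + lam) * \<epsilon> (r k)) \<longlonglongrightarrow> m + (1 + lam) * 0"
      by (intro tendsto_add tendsto_mult tendsto_const \<epsilon>_lim_r)
    have "F (s k) + lam * K k \<le> m + (1 + lam) * \<epsilon> k" for k using val[of k] K(3)[of k] by linarith
    then show "\<exists>n. \<forall>k\<ge>n. F (s (r k)) + lam * K (r k) \<le> m + (1 + lam) * \<epsilon> (r k)" by blast
  qed
  then have opt: "F g + lam * K0 \<le> m" by simp
  have "conic_rep I \<psi> (UNIV \<times> ?Ext) g K0"
    using g unfolding \<psi>_def A_def by (rule conic_rep_atom_convex_hull[OF hull])
  moreover have "(UNIV :: 'w set) \<times> ?Ext \<noteq> {}" using Ext_ne by blast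
  ultimately have "\<exists>t a. (\<forall>m. t m \<in> UNIV \<times> ?Ext) \<and> (\<forall>m. 0 \<le> a m) \<and> (\<Sum>m=1..card I. a m) \<le> K0 \<and>
      (\<forall>i\<in>I. g i = (\<Sum>m=1..card I. a m * \<psi> (t m) i))"
    by (rule conic_rep_indexed[OF finI])
  then obtain t a where t: "\<forall>m. t m \<in> UNIV \<times> ?Ext" and a: "\<forall>m. 0 \<le> a m" "sum a {1..card I} \<le> K0"
    and g_eq: "\<forall>i\<in>I. g i = (\<Sum>m=1..card I. a m * \<psi> (t m) i)" by blast
  define S where "S = {1..N * CARD('d)}"
  define w where "w m = fst (t m)" for m
  define u where "u m = snd (t m)" for m
  have u: "u m extreme_point_of ?B" for m using t by (auto simp: u_def mem_Times_iff)
  define \<mu> where "\<mu> = dirac_sum S a w u"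
  have finS: "finite S" by (simp add: S_def)
  have \<mu>: "\<mu> \<in> vv_measures" unfolding \<mu>_def by (rule dirac_sum_in_vv_measures[OF finS])
  have f: "rkbs_op \<phi> \<mu> = (\<lambda>\<xi>. \<Sum>m\<in>S. (a m * \<phi> (\<xi>, w m)) *\<^sub>R u m)"
    unfolding \<mu>_def by (rule rkbs_op_dirac_sum[OF \<phi> finS])
  have f_rkbs: "rkbs_op \<phi> \<mu> \<in> rkbs \<phi>" using \<mu> by (auto simp: rkbs_def)
  have smp_f: "smp (rkbs_op \<phi> \<mu>) i = g i" if "i \<in> I" for i
    using g_eq[rule_format, OF that] unfolding cardI S_def[symmetric] smp_def f
    by (simp add: M.sum M.scaleR \<psi>_def atom_def w_def u_def mult.assoc)
  have "F (smp (rkbs_op \<phi> \<mu>)) = F g"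
    unfolding F_def using smp_f by (simp add: I_def)
  \<comment> \<open>Only this direction is required, because \<open>m\<close> already bounds the
    objective from below.\<close>
  moreover have "rkbs_norm \<phi> (rkbs_op \<phi> \<mu>) \<le> K0"
  proof -
    have "rkbs_norm \<phi> (rkbs_op \<phi> \<mu>) \<le> mass \<mu>" by (rule rkbs_norm_le_mass[OF \<mu>])
    also have "\<dots> \<le> (\<Sum>m\<in>S. \<bar>a m\<bar> * norm (u m))" unfolding \<mu>_def by (rule mass_dirac_sum_le[OF finS])
    also have "\<dots> \<le> (\<Sum>m\<in>S. a m)"
    proof (rule sum_mono)
      fix m
      have "norm (u m) \<le> 1" using u[of m] by (simp add: extreme_point_of_def)
      then show "\<bar>a m\<bar> * norm (u m) \<le> a m" using a(1) by (simp add: mult_left_le)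
    qed
    also have "\<dots> \<le> K0" using a(2) by (simp add: S_def cardI)
    finally show ?thesis .
  qed
  ultimately have "obj (rkbs_op \<phi> \<mu>) \<le> m"
    unfolding obj using opt mult_left_mono[OF _ lam] by fastforce
  then have "is_arg_min obj (\<lambda>f. f \<in> rkbs \<phi>) (rkbs_op \<phi> \<mu>)"
    unfolding is_arg_min_def using f_rkbs m_le by (auto simp: not_less intro: order_trans)
  then show ?thesis
    using u \<mu> f
    by (intro exI[of _ a] exI[of _ w] exI[of _ u] exI[of _ \<mu>] exI[of _ "rkbs_op \<phi> \<mu>"])
       (simp add: \<mu>_def S_def obj_def)
qed

end
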